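(* The tropicalization map $\mathrm{trop}\colon(\mathrm{Gr}_0(2,n)/\mathbb G_m^n)^{\mathrm{an}}\to M_{\mathbb R}^\vee/L$ has a continuous section $\sigma'\colon\mathcal{T}\mathrm{Gr}_0(2,n)/\overline L\to(\mathrm{Gr}_0(2,n)/\mathbb G_m^n)^{\mathrm{an}}$; that is, $\sigma'$ is continuous and $\mathrm{trop}(\sigma'(z))=z$ for every $z\in\mathcal{T}\mathrm{Gr}_0(2,n)/\overline L\subset M_{\mathbb R}^\vee/L$.
   Context: $K$ is a field complete with respect to a non-Archimedean absolute value $|\cdot|$ (possibly trivial); $^{\mathrm{an}}$ is Berkovich analytification (for $\operatorname{Spec}B$: multiplicative seminorms on $B$ extending $|\cdot|$, topology of pointwise convergence). $\mathrm{Gr}(2,n)\subset\mathbb P_K^{\binom n2-1}$ is embedded by Plücker coordinates $p_{kl}$, $kl\in\binom{[n]}2$, and $\mathrm{Gr}_0(2,n)$ is the open affine subvariety where all $p_{kl}\ne0$, a closed subscheme of the torus $\mathbb G_m^{\binom n2}/\mathbb G_m$. $\mathcal{T}\mathrm{Gr}_0(2,n)\subset\mathbb R^{\binom n2}/\mathbb R\cdot\mathbf 1$ is the image of $\mathrm{Gr}_0(2,n)^{\mathrm{an}}$ under $\gamma\mapsto(\log\gamma(p_{kl}))_{kl}$ modulo $\mathbb R\cdot\mathbf 1$, i.e. the class of $x$ with $x_{kl}-x_{ij}=\log\gamma(p_{kl}/p_{ij})$. $M=\mathbb Z^{\binom n2}$, $M^\vee_{\mathbb R}=\mathbb R^{\binom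 n2}$. For $k\in[n]$ let $\mathbf l_k\in M^\vee$ be the vector with $(\mathbf l_k)_{rs}=1$ if $k\in\{r,s\}$ and $0$ otherwise; $L\subset M^\vee_{\mathbb R}$ is the real span of $\mathbf l_1,\dots,\mathbf l_n$ (it contains $\mathbf 1$), and $\overline L=L/\mathbb R\cdot\mathbf 1$. One has $\mathcal{T}\mathrm{Gr}_0(2,n)+\overline L=\mathcal{T}\mathrm{Gr}_0(2,n)$, and $\mathcal{T}\mathrm{Gr}_0(2,n)/\overline L$ is its image in $(\mathbb R^{\binom n2}/\mathbb R\mathbf 1)/\overline L=M_{\mathbb R}^\vee/L$, with the induced topology. $\mathbb G_m^n$ acts on $\mathrm{Gr}_0(2,n)$ by $(t_i)\cdot(p_{kl})=(t_kt_lp_{kl})$; the geometric quotient $\mathrm{Gr}_0(2,n)/\mathbb G_m^n$ is $\operatorname{Spec}$ of the ring of invariants of $K[\mathrm{Gr}_0(2,n)]$. Let $N=\{\alpha\in\mathbb Z^{\binom n2}:\sum_{l\ne k}\alpha_{kl}=0\text{ for all }k\in[n]\}$ be the lattice of invariant monomials $p^\alpha$; then $\operatorname{Hom}(N,\mathbb R)=M_{\mathbb R}^\vee/L$, the quotient embeds in the torus $\operatorname{Spec}K[N]$, and $\mathrm{trop}\colon(\mathrm{Gr}_0(2,n)/\mathbb G_m^n)^{\mathrm{an}}\to M_{\mathbb R}^\vee/L$ is $\gamma\mapsto(\alpha\mapsto\log\gamma(p^\alpha))$. The image of this map is $\mathcal{T}\mathrm{Gr}_0(2,n)/\overline L$.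 *)

theory Defs
  imports "HOL-Analysis.Analysis" "HOL-Algebra.QuotRing" "HOL-Library.Poly_Mapping" "HOL-Library.Ramsey"
begin

section \<open>Complete non-Archimedean fields and Berkovich spectra\<close>

text \<open>The trivial absolute value is allowed.\<close>

definition nonarch_abs :: "('k::field \<Rightarrow> real) \<Rightarrow> bool" where
  "nonarch_abs v \<longleftrightarrow>
     (\<forall>x. 0 \<le> v x) \<and> (\<forall>x. v x = 0 \<longleftrightarrow> x = 0) \<and>
     (\<forall>x y. v (x * y) = v x * v y) \<and> (\<forall>x y. v (x + y) \<le> max (v x) (v y))"

definition complete_nonarch_abs :: "('k::field \<Rightarrow> real) \<Rightarrow> bool" where
  "complete_nonarch_abs v \<longleftrightarrow>
     nonarch_abs v \<and> Metric_space.mcomplete UNIV (\<lambda>x y. v (x - y))"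

text \<open>
  For a ring \<open>B\<close> that is a \<open>K\<close>-algebra via the structure map \<open>\<iota>\<close>: the multiplicative seminorms
  on \<open>B\<close> extending \<open>v\<close>. They are extensional on the carrier, so that the set lies in the
  topspace of the product topology, which is the topology of pointwise convergence.
\<close>

definition berkovich_spec ::
  "('k::field \<Rightarrow> real) \<Rightarrow> ('k \<Rightarrow> 'b) \<Rightarrow> ('b, 'm) ring_scheme \<Rightarrow> ('b \<Rightarrow> real) set" where
  "berkovich_spec v \<iota> B =
     {\<gamma> \<in> carrier B \<rightarrow>\<^sub>E {0..}.
        \<gamma> \<zero>\<^bsub>B\<^esub> = 0 \<and> \<gamma> \<one>\<^bsub>B\<^esub> = 1 \<and>
        (\<forall>f\<in>carrier B. \<forall>g\<in>carrier B. \<gamma> (f \<oplus>\<^bsub>B\<^esub> g) \<le> \<gamma> f + \<gamma> g) \<and>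
        (\<forall>f\<in>carrier B. \<forall>g\<in>carrier B. \<gamma> (f \<otimes>\<^bsub>B\<^esub> g) = \<gamma> f * \<gamma> g) \<and>
        (\<forall>c. \<gamma> (\<iota> c) = v c)}"

definition berkovich_topology ::
  "('k::field \<Rightarrow> real) \<Rightarrow> ('k \<Rightarrow> 'b) \<Rightarrow> ('b, 'm) ring_scheme \<Rightarrow> ('b \<Rightarrow> real) topology" where
  "berkovich_topology v \<iota> B =
     subtopology (product_topology (\<lambda>_. euclideanreal) (carrier B)) (berkovich_spec v \<iota> B)"

lemma topspace_berkovich_topology [simp]:
  "topspace (berkovich_topology v \<iota> B) = berkovich_spec v \<iota> B"
  by (auto simp: berkovich_topology_def berkovich_spec_def PiE_def Pi_def)


section \<open>The Grassmannian of planes and its torus quotient\<close>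

text \<open>
  Pluecker indices are the two-element subsets of \<open>{1..n}\<close>. Laurent monomials \<open>p\<^sup>\<alpha>\<close> have exponents
  \<open>\<alpha> \<in> \<int>\<^bsup>pairs n\<^esup>\<close>, and the Laurent polynomial ring is the group algebra of this lattice.
\<close>

abbreviation pairs :: "nat \<Rightarrow> nat set set" where
  "pairs n \<equiv> nsets {1..n} 2"

type_synonym expo = "nat set \<Rightarrow>\<^sub>0 int"
type_synonym 'k laurent = "expo \<Rightarrow>\<^sub>0 'k"

definition expo_lattice :: "nat \<Rightarrow> expo set" where
  "expo_lattice n = {\<alpha>. Poly_Mapping.keys \<alpha> \<subseteq> pairs n}"

definition laurent_ring :: "nat \<Rightarrow> 'k::field laurent ring" where
  "laurent_ring n =
     \<lparr>carrier = {f. Poly_Mapping.keys f \<subseteq> expo_lattice n},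
      mult = (*), one = 1, zero = 0, add = (+)\<rparr>"

definition unit_expo :: "nat set \<Rightarrow> expo" where
  "unit_expo e = Poly_Mapping.single e 1"

definition plucker_var :: "nat \<Rightarrow> nat \<Rightarrow> 'k::field laurent" where
  "plucker_var k l = Poly_Mapping.single (unit_expo {k, l}) 1"

definition plucker_relations :: "nat \<Rightarrow> 'k::field laurent set" where
  "plucker_relations n =
     {plucker_var i j * plucker_var k l - plucker_var i k * plucker_var j l
        + plucker_var i l * plucker_var j k | i j k l.
      1 \<le> i \<and> i < j \<and> j < k \<and> k < l \<and> l \<le> n}"

definition plucker_ideal :: "nat \<Rightarrow> 'k::field laurent set" where
  "plucker_ideal n = Idl\<^bsub>laurent_ring n\<^esub> (plucker_relations n)"

definition laurent_class :: "nat \<Rightarrow> 'k::field laurent \<Rightarrow> 'k laurent set" where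
  "laurent_class n f = plucker_ideal n +>\<^bsub>laurent_ring n\<^esub> f"

definition monomial_class :: "nat \<Rightarrow> expo \<Rightarrow> 'k::field laurent set" where
  "monomial_class n \<alpha> = laurent_class n (Poly_Mapping.single \<alpha> 1)"

definition const_class :: "nat \<Rightarrow> 'k::field \<Rightarrow> 'k laurent set" where
  "const_class n c = laurent_class n (Poly_Mapping.single 0 c)"

text \<open>
  \<open>laurent_ring n Quot plucker_ideal n\<close> is the homogeneous coordinate ring of the Grassmannian,
  localized at the product of all Pluecker coordinates. The coordinate ring of the locus in
  projective space where all of them are nonzero is its degree-zero part.
\<close>

definition Gr0_ring :: "nat \<Rightarrow> 'k::field laurent set ring" where
  "Gr0_ring n =
     (laurent_ring n Quot plucker_ideal n)
       \<lparr>carrier := {laurent_class n f | f. f \<in> carrier (laurent_ring n) \<and>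
          (\<forall>\<alpha>\<in>Poly_Mapping.keys f. (\<Sum>e\<in>pairs n. Poly_Mapping.lookup \<alpha> e) = 0)}\<rparr>"

text \<open>
  The coaction \<open>p\<^sub>k\<^sub>l \<mapsto> t\<^sub>k t\<^sub>l p\<^sub>k\<^sub>l\<close> of \<open>\<G>\<^sub>m\<^sup>n\<close>, with values in the Laurent polynomials in \<open>t\<close>
  over the Laurent polynomials in \<open>p\<close>. A class is invariant if its image under the coaction is
  itself, as a constant in \<open>t\<close>; equality in the Laurent polynomials in \<open>t\<close> over the quotient
  ring is equality of the classes of all coefficients. (The ideal is stable under the
  coaction, so the choice of the representative does not matter.)
\<close>

definition torus_weight :: "expo \<Rightarrow> (nat \<Rightarrow>\<^sub>0 int)" where
  "torus_weight \<alpha> =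
     (\<Sum>e\<in>Poly_Mapping.keys \<alpha>. \<Sum>k\<in>e. Poly_Mapping.single k (Poly_Mapping.lookup \<alpha> e))"

definition coaction :: "'k::field laurent \<Rightarrow> ((nat \<Rightarrow>\<^sub>0 int) \<Rightarrow>\<^sub>0 'k laurent)" where
  "coaction f =
     (\<Sum>\<alpha>\<in>Poly_Mapping.keys f.
        Poly_Mapping.single (torus_weight \<alpha>) (Poly_Mapping.single \<alpha> (Poly_Mapping.lookup f \<alpha>)))"

definition torus_invariant :: "nat \<Rightarrow> 'k::field laurent set \<Rightarrow> bool" where
  "torus_invariant n X \<longleftrightarrow>
     (\<forall>f\<in>X. \<forall>w. laurent_class n (Poly_Mapping.lookup (coaction f) w)
                = laurent_class n (Poly_Mapping.lookup (Poly_Mapping.single 0 f) w))"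

definition Gr0_quotient_ring :: "nat \<Rightarrow> 'k::field laurent set ring" where
  "Gr0_quotient_ring n =
     (Gr0_ring n)\<lparr>carrier := {X \<in> carrier (Gr0_ring n). torus_invariant n X}\<rparr>"

definition Gr0_an :: "('k::field \<Rightarrow> real) \<Rightarrow> nat \<Rightarrow> ('k laurent set \<Rightarrow> real) set" where
  "Gr0_an v n = berkovich_spec v (const_class n) (Gr0_ring n)"

definition Gr0_quotient_an ::
  "('k::field \<Rightarrow> real) \<Rightarrow> nat \<Rightarrow> ('k laurent set \<Rightarrow> real) topology" where
  "Gr0_quotient_an v n = berkovich_topology v (const_class n) (Gr0_quotient_ring n)"


section \<open>The tropical side\<close>

text \<open>
  Points of \<open>M\<^sup>\<or>\<^sub>\<real>\<close> are extensional functions on \<open>pairs n\<close>; a quotient by a subspace is the set of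
  its cosets.
\<close>

definition Mdual :: "nat \<Rightarrow> (nat set \<Rightarrow> real) set" where
  "Mdual n = (\<Pi>\<^sub>E e\<in>pairs n. UNIV)"

definition Mdual_topology :: "nat \<Rightarrow> (nat set \<Rightarrow> real) topology" where
  "Mdual_topology n = product_topology (\<lambda>_. euclideanreal) (pairs n)"

lemma topspace_Mdual_topology [simp]: "topspace (Mdual_topology n) = Mdual n"
  by (simp add: Mdual_topology_def Mdual_def)

definition lineality_vector :: "nat \<Rightarrow> nat set \<Rightarrow> real" where
  "lineality_vector k e = (if k \<in> e then 1 else 0)"

definition lineality_space :: "nat \<Rightarrow> (nat set \<Rightarrow> real) set" where
  "lineality_space n =
     {\<lambda>e\<in>pairs n. \<Sum>k\<in>{1..n}. c k * lineality_vector k e | c :: nat \<Rightarrow> real. True}"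

definition vec_coset ::
  "nat \<Rightarrow> (nat set \<Rightarrow> real) set \<Rightarrow> (nat set \<Rightarrow> real) \<Rightarrow> (nat set \<Rightarrow> real) set" where
  "vec_coset n V x = {\<lambda>e\<in>pairs n. x e + y e | y. y \<in> V}"

definition quotient_topology :: "'a topology \<Rightarrow> ('a \<Rightarrow> 'b) \<Rightarrow> 'b topology" where
  "quotient_topology X f =
     topology (\<lambda>U. U \<subseteq> f ` topspace X \<and> openin X {x \<in> topspace X. f x \<in> U})"

lemma openin_quotient_topology:
  "openin (quotient_topology X f) U \<longleftrightarrow>
     U \<subseteq> f ` topspace X \<and> openin X {x \<in> topspace X. f x \<in> U}"
proof -
  have "istopology (\<lambda>U. U \<subseteq> f ` topspace X \<and> openin X {x \<in> topspace X. f x \<in> U})"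
    unfolding istopology_def
  proof (intro conjI allI impI)
    fix S T
    assume "S \<subseteq> f ` topspace X \<and> openin X {x \<in> topspace X. f x \<in> S}"
      and "T \<subseteq> f ` topspace X \<and> openin X {x \<in> topspace X. f x \<in> T}"
    moreover have "{x \<in> topspace X. f x \<in> S \<inter> T} =
        {x \<in> topspace X. f x \<in> S} \<inter> {x \<in> topspace X. f x \<in> T}"
      by blast
    ultimately show "S \<inter> T \<subseteq> f ` topspace X" "openin X {x \<in> topspace X. f x \<in> S \<inter> T}"
      by auto
  next
    fix \<K>
    assume *: "\<forall>K\<in>\<K>. K \<subseteq> f ` topspace X \<and> openin X {x \<in> topspace X. f x \<in> K}"
    then show "\<Union>\<K> \<subseteq> f ` topspace X"
      by blast
    have "{x \<in> topspace X. f x \<in> \<Union>\<K>} = (\<Union>K\<in>\<K>. {x \<in> topspace X. f x \<in> K})"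
      by blast
    then show "openin X {x \<in> topspace X. f x \<in> \<Union>\<K>}"
      using * by auto
  qed
  then show ?thesis
    by (simp add: quotient_topology_def)
qed

lemma topspace_quotient_topology [simp]:
  "topspace (quotient_topology X f) = f ` topspace X"
proof
  show "topspace (quotient_topology X f) \<subseteq> f ` topspace X"
    by (meson openin_quotient_topology openin_topspace)
  have "{x \<in> topspace X. f x \<in> f ` topspace X} = topspace X"
    by blast
  then have "openin (quotient_topology X f) (f ` topspace X)"
    by (simp add: openin_quotient_topology)
  then show "f ` topspace X \<subseteq> topspace (quotient_topology X f)"
    by (rule openin_subset)
qed

lemma quotient_map_quotient_topology: "quotient_map X (quotient_topology X f) f"
  by (auto simp: quotient_map_def openin_quotient_topology)

definition Mdual_mod_L_topology :: "nat \<Rightarrow> (nat set \<Rightarrow> real) set topology" where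
  "Mdual_mod_L_topology n =
     quotient_topology (Mdual_topology n) (vec_coset n (lineality_space n))"

text \<open>The class of \<open>(log \<gamma>(p\<^sub>k\<^sub>l))\<^sub>k\<^sub>l\<close> modulo \<open>\<real>\<cdot>\<one>\<close>, as a coset of \<open>\<real>\<cdot>\<one>\<close>.\<close>

definition trop_Gr0_point :: "nat \<Rightarrow> ('k::field laurent set \<Rightarrow> real) \<Rightarrow> (nat set \<Rightarrow> real) set" where
  "trop_Gr0_point n \<gamma> =
     {x \<in> Mdual n. \<forall>e\<in>pairs n. \<forall>e'\<in>pairs n.
        x e - x e' = ln (\<gamma> (monomial_class n (unit_expo e - unit_expo e')))}"

definition trop_Gr0 :: "('k::field \<Rightarrow> real) \<Rightarrow> nat \<Rightarrow> (nat set \<Rightarrow> real) set set" where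
  "trop_Gr0 v n = trop_Gr0_point n ` Gr0_an v n"

text \<open>The image of the set of \<open>\<real>\<cdot>\<one>\<close>-cosets \<open>trop_Gr0 v n\<close> under the projection to \<open>M\<^sup>\<or>\<^sub>\<real>/L\<close>.\<close>

definition trop_Gr0_mod_L :: "('k::field \<Rightarrow> real) \<Rightarrow> nat \<Rightarrow> (nat set \<Rightarrow> real) set set" where
  "trop_Gr0_mod_L v n =
     (\<lambda>z. \<Union>x\<in>z. vec_coset n (lineality_space n) x) ` trop_Gr0 v n"

definition invariant_lattice :: "nat \<Rightarrow> expo set" where
  "invariant_lattice n =
     {\<alpha> \<in> expo_lattice n. \<forall>k\<in>{1..n}. (\<Sum>l\<in>{1..n} - {k}. Poly_Mapping.lookup \<alpha> {k, l}) = 0}"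

definition pairing :: "nat \<Rightarrow> (nat set \<Rightarrow> real) \<Rightarrow> expo \<Rightarrow> real" where
  "pairing n x \<alpha> = (\<Sum>e\<in>pairs n. x e * of_int (Poly_Mapping.lookup \<alpha> e))"

text \<open>
  The identification \<open>Hom(N,\<real>) = M\<^sup>\<or>\<^sub>\<real>/L\<close>: a homomorphism corresponds to the \<open>L\<close>-coset of all
  vectors that induce it via the pairing.
\<close>

definition coset_of_hom :: "nat \<Rightarrow> (expo \<Rightarrow> real) \<Rightarrow> (nat set \<Rightarrow> real) set" where
  "coset_of_hom n h = {x \<in> Mdual n. \<forall>\<alpha>\<in>invariant_lattice n. pairing n x \<alpha> = h \<alpha>}"

definition trop :: "nat \<Rightarrow> ('k::field laurent set \<Rightarrow> real) \<Rightarrow> (nat set \<Rightarrow> real) set" where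
  "trop n \<gamma> = coset_of_hom n (\<lambda>\<alpha>. ln (\<gamma> (monomial_class n \<alpha>)))"

end

theory Submission
  imports Defs "HOL-Computational_Algebra.Fraction_Field"
begin

text \<open>
  Normalizing \<open>p\<^sub>k\<^sub>n = 1\<close> turns a point of the quotient into \<open>n - 1\<close> distinct points \<open>z\<^sub>k\<close> on the
  affine line up to affine maps, with \<open>p\<^sub>k\<^sub>l = z\<^sub>l - z\<^sub>k\<close>, and turns a tropical point into an ultrametric
  \<open>u\<close> on \<open>{1..<n}\<close>, since the three-term Pluecker relations with index \<open>n\<close> become the ultrametric
  inequality. Give every \<open>k \<ge> 2\<close> a nearest earlier point \<open>p k < k\<close>. The section sends \<open>u\<close> to the
  Gauss norm in the coordinates \<open>w\<^sub>k = z\<^sub>k - z\<^bsub>p k\<^esub>\<close> with radii \<open>u k (p k)\<close>; by the ultrametric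
  inequality \<open>z\<^sub>k - z\<^sub>l\<close> then has norm \<open>u k l\<close> for all \<open>k \<noteq> l\<close>. A Gauss norm is the largest
  non-Archimedean norm with given values on the coordinates, so two choices of nearest points give
  norms that bound each other, hence the same norm. For a fixed \<open>p\<close> the Gauss norm is continuous
  in the radii, and the finitely many sets of ultrametrics for which \<open>p\<close> chooses nearest points
  are closed and cover everything, so the section is continuous.
\<close>

section \<open>Non-Archimedean absolute values\<close>

text \<open>The largest-norm property only concerns Laurent polynomials in the coordinates
  \<open>w_k\<close>. A Pluecker coordinate becomes a sum of coordinates, its inverse a genuine
  fraction, and upper bounds for a numerator and a denominator say nothing about their quotient. The
  comparison of two choices of nearest points survives because every denominator that occurs is a
  product of differences z_l - z_k, whose norm is the same in all these coordinate systems.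

  The vectors hold logarithms, so an element of \<open>ultrametrics\<close> is the logarithm of an
  ultrametric and the radii are exponentials. Fixing p_kn = 1 leaves the affine maps: z_1 = 0
  disposes of translations, and the remaining scaling, which shifts the logarithmic ultrametric by a
  constant, is fixed by making the entry at {1,2} zero.

  A point of the analytic space is only assumed subadditive. The maximum inequality behind the
  ultrametric property has to be extracted from powers of sums, using that integers have absolute
  value at most 1.\<close>

locale nonarch_absolute_value =
  fixes v :: "'k::field \<Rightarrow> real"
  assumes nonarch: "nonarch_abs v"
begin

lemma nonneg [simp]: "0 \<le> v x"
  and zero_iff [simp]: "v x = 0 \<longleftrightarrow> x = 0"
  and mult: "v (x * y) = v x * v y"
  and add_le: "v (x + y) \<le> max (v x) (v y)"
  using nonarch by (auto simp: nonarch_abs_def)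

lemma pos [simp]: "0 < v x \<longleftrightarrow> x \<noteq> 0"
  using nonneg[of x] zero_iff[of x] by linarith

lemma zero [simp]: "v 0 = 0"
  by simp

lemma one [simp]: "v 1 = 1"
  using mult[of 1 1] zero_iff[of 1] by simp

lemma minus [simp]: "v (- x) = v x"
proof -
  have "(v (- 1))\<^sup>2 = 1"
    using mult[of "- 1" "- 1"] by (simp add: power2_eq_square)
  then have "v (- 1) = 1"
    using nonneg[of "- 1"] by (simp add: power2_eq_1_iff)
  then show ?thesis
    using mult[of "- 1" x] by simp
qed

lemma diff_le: "v (x - y) \<le> max (v x) (v y)"
  using add_le[of x "- y"] by simp

lemma sum_le:
  assumes "0 \<le> C" and "\<And>a. a \<in> A \<Longrightarrow> v (f a) \<le> C"
  shows "v (sum f A) \<le> C"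
  using assms(2)
proof (induction A rule: infinite_finite_induct)
  case (insert a A)
  then show ?case
    using add_le[of "f a" "sum f A"] by fastforce
qed (use assms(1) in auto)

lemma sum_less:
  assumes "0 < C" and "\<And>a. a \<in> A \<Longrightarrow> v (f a) < C"
  shows "v (sum f A) < C"
  using assms(2)
proof (induction A rule: infinite_finite_induct)
  case (insert a A)
  then show ?case
    using add_le[of "f a" "sum f A"] by fastforce
qed (use assms(1) in auto)

text \<open>A strictly dominant summand decides the value of a non-Archimedean sum. This isolates
  the leading term in \<open>gauss_mult\<close>.\<close>

lemma eq_if_close:
  assumes "v (x - y) < v y"
  shows "v x = v y"
  using assms add_le[of "x - y" y] diff_le[of x "x - y"] by auto

lemma of_nat_le: "v (of_nat m) \<le> 1"
  using sum_le[of 1 "{..<m}" "\<lambda>_. 1"] by simp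

lemma inverse: "v (inverse x) = inverse (v x)"
proof (cases "x = 0")
  case False
  then have "v x * v (inverse x) = 1"
    by (simp flip: mult)
  with False show ?thesis
    by (simp add: field_simps)
qed simp

lemma power: "v (x ^ m) = v x ^ m"
  by (induction m) (auto simp: mult)

lemma power_int: "v (x powi m) = v x powi m"
  by (simp add: power_int_def power inverse)

lemma prod: "v (prod f A) = (\<Prod>a\<in>A. v (f a))"
  by (induction A rule: infinite_finite_induct) (auto simp: mult)

end

section \<open>Evaluation of Laurent polynomials\<close>

definition laurent_monomial :: "('i \<Rightarrow> 'f::field) \<Rightarrow> ('i \<Rightarrow>\<^sub>0 int) \<Rightarrow> 'f" where
  "laurent_monomial h \<alpha> = (\<Prod>i\<in>Poly_Mapping.keys \<alpha>. h i powi Poly_Mapping.lookup \<alpha> i)"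

lemma laurent_monomial_superset:
  assumes "finite A" "Poly_Mapping.keys \<alpha> \<subseteq> A"
  shows "laurent_monomial h \<alpha> = (\<Prod>i\<in>A. h i powi Poly_Mapping.lookup \<alpha> i)"
  unfolding laurent_monomial_def using assms
  by (intro prod.mono_neutral_left) (auto simp: in_keys_iff)

lemma laurent_monomial_0 [simp]: "laurent_monomial h 0 = 1"
  by (simp add: laurent_monomial_def)

lemma laurent_monomial_single [simp]: "laurent_monomial h (Poly_Mapping.single i m) = h i powi m"
  by (simp add: laurent_monomial_def)

lemma laurent_monomial_add:
  assumes "\<And>i. h i \<noteq> 0"
  shows "laurent_monomial h (\<alpha> + \<beta>) = laurent_monomial h \<alpha> * laurent_monomial h \<beta>"
proof -
  let ?A = "Poly_Mapping.keys \<alpha> \<union> Poly_Mapping.keys \<beta>"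
  have "laurent_monomial h (\<alpha> + \<beta>) = (\<Prod>i\<in>?A. h i powi Poly_Mapping.lookup (\<alpha> + \<beta>) i)"
    by (intro laurent_monomial_superset) (auto simp: Poly_Mapping.keys_add)
  also have "\<dots> = (\<Prod>i\<in>?A. h i powi Poly_Mapping.lookup \<alpha> i) *
      (\<Prod>i\<in>?A. h i powi Poly_Mapping.lookup \<beta> i)"
    by (simp add: lookup_add power_int_add assms prod.distrib)
  finally show ?thesis
    by (simp add: laurent_monomial_superset[of ?A])
qed

lemma laurent_monomial_pos:
  fixes h :: "'i \<Rightarrow> real"
  assumes "\<And>i. 0 < h i"
  shows "0 < laurent_monomial h \<alpha>"
  unfolding laurent_monomial_def using assms by (intro prod_pos) auto

lemma (in nonarch_absolute_value) laurent_monomial: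
  "v (laurent_monomial h \<alpha>) = laurent_monomial (\<lambda>i. v (h i)) \<alpha>"
  by (simp add: laurent_monomial_def prod power_int)

lemma sum_monomials:
  "(\<Sum>\<alpha>\<in>Poly_Mapping.keys f. Poly_Mapping.single \<alpha> (Poly_Mapping.lookup f \<alpha>)) = f"
proof (rule poly_mapping_eqI)
  fix \<beta>
  show "Poly_Mapping.lookup
      (\<Sum>\<alpha>\<in>Poly_Mapping.keys f. Poly_Mapping.single \<alpha> (Poly_Mapping.lookup f \<alpha>)) \<beta> =
      Poly_Mapping.lookup f \<beta>"
    by (cases "\<beta> \<in> Poly_Mapping.keys f")
      (auto simp: lookup_sum lookup_single when_def sum.delta in_keys_iff)
qed

lemma times_eq_sum_monomials:
  fixes f g :: "'a::comm_monoid_add \<Rightarrow>\<^sub>0 'b::comm_semiring_0"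
  shows "f * g = (\<Sum>(\<alpha>, \<beta>)\<in>Poly_Mapping.keys f \<times> Poly_Mapping.keys g.
     Poly_Mapping.single (\<alpha> + \<beta>) (Poly_Mapping.lookup f \<alpha> * Poly_Mapping.lookup g \<beta>))"
proof -
  have "f * g = (\<Sum>\<alpha>\<in>Poly_Mapping.keys f. Poly_Mapping.single \<alpha> (Poly_Mapping.lookup f \<alpha>)) *
      (\<Sum>\<alpha>\<in>Poly_Mapping.keys g. Poly_Mapping.single \<alpha> (Poly_Mapping.lookup g \<alpha>))"
    by (simp add: sum_monomials)
  then show ?thesis
    by (simp add: sum_product mult_single sum.cartesian_product)
qed

text \<open>Used for evaluating Pluecker coordinates and for changing coordinates between two
  choices of nearest points. Asking every \<open>h i\<close> to be nonzero, even at junk indices,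
  spares all side conditions on exponents.\<close>

locale laurent_evaluation =
  fixes c :: "'k::comm_ring_1 \<Rightarrow> 'f::field" and h :: "'i \<Rightarrow> 'f"
  assumes c_0 [simp]: "c 0 = 0" and c_1 [simp]: "c 1 = 1"
    and c_add: "c (x + y) = c x + c y" and c_mult: "c (x * y) = c x * c y"
    and h_nonzero [simp]: "h i \<noteq> 0"
begin

definition eval :: "(('i \<Rightarrow>\<^sub>0 int) \<Rightarrow>\<^sub>0 'k) \<Rightarrow> 'f" where
  "eval f = (\<Sum>\<alpha>\<in>Poly_Mapping.keys f. c (Poly_Mapping.lookup f \<alpha>) * laurent_monomial h \<alpha>)"

lemma eval_superset:
  assumes "finite A" "Poly_Mapping.keys f \<subseteq> A"
  shows "eval f = (\<Sum>\<alpha>\<in>A. c (Poly_Mapping.lookup f \<alpha>) * laurent_monomial h \<alpha>)"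
  unfolding eval_def using assms by (intro sum.mono_neutral_left) (auto simp: in_keys_iff)

lemma eval_0 [simp]: "eval 0 = 0"
  by (simp add: eval_def)

lemma eval_single [simp]: "eval (Poly_Mapping.single \<alpha> a) = c a * laurent_monomial h \<alpha>"
  by (simp add: eval_def)

lemma eval_1 [simp]: "eval 1 = 1"
  using eval_single[of 0 1] by (simp del: eval_single)

lemma eval_add: "eval (f + g) = eval f + eval g"
proof -
  let ?A = "Poly_Mapping.keys f \<union> Poly_Mapping.keys g"
  have "eval (f + g) = (\<Sum>\<alpha>\<in>?A. c (Poly_Mapping.lookup (f + g) \<alpha>) * laurent_monomial h \<alpha>)"
    by (intro eval_superset) (auto simp: Poly_Mapping.keys_add)
  also have "\<dots> = (\<Sum>\<alpha>\<in>?A. c (Poly_Mapping.lookup f \<alpha>) * laurent_monomial h \<alpha>) +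
      (\<Sum>\<alpha>\<in>?A. c (Poly_Mapping.lookup g \<alpha>) * laurent_monomial h \<alpha>)"
    by (simp add: lookup_add c_add distrib_right sum.distrib)
  finally show ?thesis
    by (simp add: eval_superset[of ?A])
qed

lemma eval_sum: "eval (sum f A) = (\<Sum>a\<in>A. eval (f a))"
  by (induction A rule: infinite_finite_induct) (auto simp: eval_add)

lemma eval_uminus: "eval (- f) = - eval f"
  using eval_add[of f "- f"] by (simp add: eq_neg_iff_add_eq_0 add.commute)

lemma eval_diff: "eval (f - g) = eval f - eval g"
  using eval_add[of f "- g"] by (simp add: eval_uminus)

lemma eval_mult: "eval (f * g) = eval f * eval g"
proof -
  have "eval (f * g) = (\<Sum>(\<alpha>, \<beta>)\<in>Poly_Mapping.keys f \<times> Poly_Mapping.keys g.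
      (c (Poly_Mapping.lookup f \<alpha>) * laurent_monomial h \<alpha>) *
      (c (Poly_Mapping.lookup g \<beta>) * laurent_monomial h \<beta>))"
    by (simp add: times_eq_sum_monomials eval_sum split_def laurent_monomial_add c_mult mult_ac)
  then show ?thesis
    by (simp add: eval_def sum_product sum.cartesian_product)
qed

end

section \<open>Gauss norms\<close>

definition gauss_norm ::
  "('k::zero \<Rightarrow> real) \<Rightarrow> ('i \<Rightarrow> real) \<Rightarrow> (('i \<Rightarrow>\<^sub>0 int) \<Rightarrow>\<^sub>0 'k) \<Rightarrow> real" where
  "gauss_norm v r f =
     Max (insert 0 ((\<lambda>\<alpha>. v (Poly_Mapping.lookup f \<alpha>) * laurent_monomial r \<alpha>) ` Poly_Mapping.keys f))"

text \<open>The linear order on the indices induces an order on exponents that is compatible with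
  addition; the leading-term argument in \<open>gauss_mult\<close> needs it.\<close>

locale gauss = nonarch_absolute_value v for v :: "'k::field \<Rightarrow> real" +
  fixes r :: "'i::linorder \<Rightarrow> real"
  assumes r_pos: "0 < r i"
begin

abbreviation G :: "(('i \<Rightarrow>\<^sub>0 int) \<Rightarrow>\<^sub>0 'k) \<Rightarrow> real" where
  "G \<equiv> gauss_norm v r"

abbreviation mon :: "('i \<Rightarrow>\<^sub>0 int) \<Rightarrow> real" where
  "mon \<equiv> laurent_monomial r"

lemma mon_pos [simp]: "0 < mon \<alpha>"
  by (simp add: laurent_monomial_pos r_pos)

lemma mon_nonzero [simp]: "mon \<alpha> \<noteq> 0"
  using mon_pos[of \<alpha>] by linarith

lemma mon_add: "mon (\<alpha> + \<beta>) = mon \<alpha> * mon \<beta>"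
  using r_pos by (intro laurent_monomial_add) (metis less_irrefl)

lemma gauss_nonneg [simp]: "0 \<le> G f"
  unfolding gauss_norm_def by (rule Max_ge) auto

lemma weight_le_gauss: "v (Poly_Mapping.lookup f \<alpha>) * mon \<alpha> \<le> G f"
proof (cases "\<alpha> \<in> Poly_Mapping.keys f")
  case True
  then show ?thesis
    unfolding gauss_norm_def by (intro Max_ge) auto
qed (simp add: in_keys_iff)

lemma gauss_leI:
  assumes "0 \<le> C" "\<And>\<alpha>. \<alpha> \<in> Poly_Mapping.keys f \<Longrightarrow> v (Poly_Mapping.lookup f \<alpha>) * mon \<alpha> \<le> C"
  shows "G f \<le> C"
  unfolding gauss_norm_def using assms by auto

lemma gauss_0 [simp]: "G 0 = 0"
  by (simp add: gauss_norm_def)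

lemma gauss_single [simp]: "G (Poly_Mapping.single \<alpha> a) = v a * mon \<alpha>"
  by (simp add: gauss_norm_def less_imp_le max_def)

lemma gauss_1 [simp]: "G 1 = 1"
  using gauss_single[of 0 1] by (simp del: gauss_single)

lemma gauss_pos: "f \<noteq> 0 \<Longrightarrow> 0 < G f"
proof -
  assume "f \<noteq> 0"
  then obtain \<alpha> where "Poly_Mapping.lookup f \<alpha> \<noteq> 0"
    by (metis lookup_zero poly_mapping_eqI)
  then have "0 < v (Poly_Mapping.lookup f \<alpha>) * mon \<alpha>"
    by simp
  then show "0 < G f"
    using weight_le_gauss[of f \<alpha>] by linarith
qed

lemma gauss_eq_0_iff [simp]: "G f = 0 \<longleftrightarrow> f = 0"
  using gauss_pos[of f] by fastforce

lemma gauss_attained: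
  assumes "f \<noteq> 0"
  obtains \<alpha> where "\<alpha> \<in> Poly_Mapping.keys f" "v (Poly_Mapping.lookup f \<alpha>) * mon \<alpha> = G f"
proof -
  have "G f \<in> insert 0 ((\<lambda>\<alpha>. v (Poly_Mapping.lookup f \<alpha>) * mon \<alpha>) ` Poly_Mapping.keys f)"
    unfolding gauss_norm_def by (intro Max_in) auto
  with gauss_pos[OF assms] show ?thesis
    using that by auto
qed

lemma gauss_add: "G (f + g) \<le> max (G f) (G g)"
proof (rule gauss_leI)
  fix \<alpha>
  have "v (Poly_Mapping.lookup (f + g) \<alpha>) * mon \<alpha> \<le>
      max (v (Poly_Mapping.lookup f \<alpha>)) (v (Poly_Mapping.lookup g \<alpha>)) * mon \<alpha>"
    by (simp add: lookup_add add_le less_imp_le mult_right_mono)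
  also have "\<dots> \<le> max (G f) (G g)"
    using weight_le_gauss[of f \<alpha>] weight_le_gauss[of g \<alpha>] by (simp add: max_def)
  finally show "v (Poly_Mapping.lookup (f + g) \<alpha>) * mon \<alpha> \<le> max (G f) (G g)" .
qed (simp add: le_max_iff_disj)

text \<open>Without common monomials nothing can cancel. This computes the norm when a new
  coordinate \<open>w_k\<close> is added to a polynomial in earlier ones.\<close>

lemma gauss_add_disjoint:
  assumes "Poly_Mapping.keys f \<inter> Poly_Mapping.keys g = {}"
  shows "G (f + g) = max (G f) (G g)"
proof (rule antisym[OF gauss_add])
  have *: "G f \<le> G (f + g)" if "Poly_Mapping.keys f \<inter> Poly_Mapping.keys g = {}" for f g
  proof (rule gauss_leI)
    fix \<alpha> assume "\<alpha> \<in> Poly_Mapping.keys f"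
    with that have "Poly_Mapping.lookup g \<alpha> = 0"
      by (auto simp: in_keys_iff)
    then show "v (Poly_Mapping.lookup f \<alpha>) * mon \<alpha> \<le> G (f + g)"
      using weight_le_gauss[of "f + g" \<alpha>] by (simp add: lookup_add)
  qed simp
  show "max (G f) (G g) \<le> G (f + g)"
    using *[OF assms] *[of g f] assms by (simp add: Int_commute add.commute)
qed

lemma gauss_uminus [simp]: "G (- f) = G f"
proof -
  have "Poly_Mapping.keys (- f) = Poly_Mapping.keys f"
    by (auto simp: in_keys_iff)
  then show ?thesis
    by (simp add: gauss_norm_def)
qed

lemma gauss_mult_le: "G (f * g) \<le> G f * G g"
proof (rule gauss_leI)
  fix \<gamma>
  let ?C = "G f * G g / mon \<gamma>"
  have "v (Poly_Mapping.lookup (f * g) \<gamma>) \<le> ?C"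
    unfolding times_eq_sum_monomials lookup_sum
  proof (rule sum_le)
    fix p assume "p \<in> Poly_Mapping.keys f \<times> Poly_Mapping.keys g"
    obtain \<alpha> \<beta> where p: "p = (\<alpha>, \<beta>)"
      by fastforce
    have "v (Poly_Mapping.lookup f \<alpha>) * mon \<alpha> * (v (Poly_Mapping.lookup g \<beta>) * mon \<beta>) \<le> G f * G g"
      by (intro mult_mono weight_le_gauss) (auto simp: less_imp_le)
    then show "v (Poly_Mapping.lookup (case p of (\<alpha>, \<beta>) \<Rightarrow>
        Poly_Mapping.single (\<alpha> + \<beta>) (Poly_Mapping.lookup f \<alpha> * Poly_Mapping.lookup g \<beta>)) \<gamma>) \<le> ?C"
      by (auto simp: p lookup_single when_def mult mon_add field_simps less_imp_le)
  qed (simp add: less_imp_le)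
  then show "v (Poly_Mapping.lookup (f * g) \<gamma>) * mon \<gamma> \<le> G f * G g"
    by (simp add: field_simps)
qed simp

text \<open>
  The largest exponents at which \<open>f\<close> and \<open>g\<close> attain their norms contribute a term to the product
  that no other pair of terms can cancel.
\<close>

lemma gauss_mult: "G (f * g) = G f * G g"
proof (cases "f = 0 \<or> g = 0")
  case False
  define A where "A = (\<lambda>f. {\<alpha> \<in> Poly_Mapping.keys f. v (Poly_Mapping.lookup f \<alpha>) * mon \<alpha> = G f})"
  define m where "m = (\<lambda>f. Max (A f))"
  have fin: "finite (A f)" for f
    by (simp add: A_def)
  have m_in: "m f \<in> A f" if "f \<noteq> 0" for f
    unfolding m_def using fin gauss_attained[OF that] by (intro Max_in) (auto simp: A_def)
  have above: "v (Poly_Mapping.lookup f \<alpha>) * mon \<alpha> < G f"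
    if "\<alpha> \<in> Poly_Mapping.keys f" "m f < \<alpha>" for f \<alpha>
  proof -
    have "\<alpha> \<notin> A f"
      using Max_ge[OF fin, of \<alpha> f] that(2) by (auto simp: m_def)
    with that(1) show ?thesis
      using weight_le_gauss[of f \<alpha>] by (simp add: A_def)
  qed
  have mf: "m f \<in> Poly_Mapping.keys f" "v (Poly_Mapping.lookup f (m f)) * mon (m f) = G f"
    and mg: "m g \<in> Poly_Mapping.keys g" "v (Poly_Mapping.lookup g (m g)) * mon (m g) = G g"
    using m_in[of f] m_in[of g] False by (auto simp: A_def)
  define \<gamma> where "\<gamma> = m f + m g"
  define t where "t = (\<lambda>(\<alpha>, \<beta>). Poly_Mapping.lookup (Poly_Mapping.single (\<alpha> + \<beta>)
      (Poly_Mapping.lookup f \<alpha> * Poly_Mapping.lookup g \<beta>)) \<gamma>)"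
  define C where "C = G f * G g / mon \<gamma>"
  let ?P = "Poly_Mapping.keys f \<times> Poly_Mapping.keys g"
  have C: "0 < C"
    using False gauss_pos by (simp add: C_def)
  have lead: "v (t (m f, m g)) = C"
  proof -
    have "C = (v (Poly_Mapping.lookup f (m f)) * mon (m f)) *
        (v (Poly_Mapping.lookup g (m g)) * mon (m g)) / (mon (m f) * mon (m g))"
      by (simp only: C_def \<gamma>_def mon_add mf(2) mg(2))
    then show ?thesis
      by (simp add: t_def \<gamma>_def mult)
  qed
  have "v (sum t (?P - {(m f, m g)})) < C"
  proof (rule sum_less[OF C])
    fix p assume p: "p \<in> ?P - {(m f, m g)}"
    obtain \<alpha> \<beta> where [simp]: "p = (\<alpha>, \<beta>)"
      by fastforce
    show "v (t p) < C"
    proof (cases "\<alpha> + \<beta> = \<gamma>")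
      case True
      have "m f < \<alpha> \<or> m g < \<beta>"
      proof (rule ccontr)
        assume "\<not> ?thesis"
        then have "\<alpha> \<le> m f" "\<beta> \<le> m g"
          by auto
        moreover have "\<alpha> \<noteq> m f \<or> \<beta> \<noteq> m g"
          using p by auto
        ultimately have "\<alpha> + \<beta> < m f + m g"
          by (metis add_le_less_mono add_less_le_mono order_le_less)
        with True show False
          by (simp add: \<gamma>_def)
      qed
      \<comment> \<open>With both weights positive, strictness in one factor makes the product
        strictly smaller.\<close>
      moreover have "0 < v (Poly_Mapping.lookup f \<alpha>) * mon \<alpha>" "0 < v (Poly_Mapping.lookup g \<beta>) * mon \<beta>"
        using p by (auto simp: in_keys_iff)
      ultimately have "v (Poly_Mapping.lookup f \<alpha>) * mon \<alpha> * (v (Poly_Mapping.lookup g \<beta>) * mon \<beta>)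
          < G f * G g"
        using above[of \<alpha> f] above[of \<beta> g] p weight_le_gauss[of f \<alpha>] weight_le_gauss[of g \<beta>]
        by (auto intro: mult_less_le_imp_less mult_le_less_imp_less less_imp_le)
      then show ?thesis
        by (simp add: t_def True C_def mult field_simps) (simp add: mon_add mult_ac flip: True)
    qed (simp add: t_def lookup_single C)
  qed
  moreover have "Poly_Mapping.lookup (f * g) \<gamma> - t (m f, m g) = sum t (?P - {(m f, m g)})"
    using mf mg by (simp add: times_eq_sum_monomials lookup_sum t_def sum_diff1 split_def)
  ultimately have "v (Poly_Mapping.lookup (f * g) \<gamma>) = C"
    using eq_if_close[of "Poly_Mapping.lookup (f * g) \<gamma>" "t (m f, m g)"] lead by simp
  then have "G f * G g \<le> G (f * g)"
    using weight_le_gauss[of "f * g" \<gamma>] by (simp add: C_def)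
  then show ?thesis
    using gauss_mult_le[of f g] by simp
qed auto

end

section \<open>Extension to fraction fields\<close>

text \<open>For a multiplicative \<open>N\<close> all representations of a fraction give the same
  quotient; \<open>GF_Fract\<close> shows this for Gauss norms.\<close>

definition fract_norm :: "('a::idom \<Rightarrow> real) \<Rightarrow> 'a fract \<Rightarrow> real" where
  "fract_norm N q = (THE t. \<exists>a b. b \<noteq> 0 \<and> q = Fract a b \<and> t = N a / N b)"

context gauss
begin

abbreviation GF :: "(('i \<Rightarrow>\<^sub>0 int) \<Rightarrow>\<^sub>0 'k) fract \<Rightarrow> real" where
  "GF \<equiv> fract_norm (gauss_norm v r)"

lemma GF_Fract: 
  assumes "b \<noteq> 0"
  shows "GF (Fract a b) = G a / G b"
  unfolding fract_norm_def
proof (rule the_equality)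
  fix t assume "\<exists>a' b'. b' \<noteq> 0 \<and> Fract a b = Fract a' b' \<and> t = G a' / G b'"
  then obtain a' b' where *: "b' \<noteq> 0" "Fract a b = Fract a' b'" and t: "t = G a' / G b'"
    by blast
  have "G a * G b' = G a' * G b"
    using assms * by (simp add: eq_fract flip: gauss_mult)
  with assms * show "t = G a / G b"
    by (simp add: t field_simps)
qed (use assms in blast)

lemma nonarch_GF: "nonarch_abs GF"
  unfolding nonarch_abs_def
proof (intro conjI allI)
  fix q :: "(('i \<Rightarrow>\<^sub>0 int) \<Rightarrow>\<^sub>0 'k) fract"
  obtain a b where q: "q = Fract a b" "b \<noteq> 0"
    by (cases q)
  show "0 \<le> GF q"
    by (simp add: q GF_Fract)
  show "GF q = 0 \<longleftrightarrow> q = 0"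
    using q by (simp add: GF_Fract Zero_fract_def eq_fract)
  fix q' :: "(('i \<Rightarrow>\<^sub>0 int) \<Rightarrow>\<^sub>0 'k) fract"
  obtain a' b' where q': "q' = Fract a' b'" "b' \<noteq> 0"
    by (cases q')
  show "GF (q * q') = GF q * GF q'"
    using q q' by (simp add: GF_Fract gauss_mult)
  have "G (a * b' + a' * b) \<le> max (G a * G b') (G a' * G b)"
    using gauss_add[of "a * b'" "a' * b"] by (simp add: gauss_mult)
  also have "\<dots> = max (G a / G b) (G a' / G b') * (G b * G b')"
    using gauss_pos[OF q(2)] gauss_pos[OF q'(2)] 
    by (subst max_mult_distrib_right) (auto simp: mult_ac)
  finally show "GF (q + q') \<le> max (GF q) (GF q')"
    using q q' gauss_pos[OF q(2)] gauss_pos[OF q'(2)]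
    by (simp add: GF_Fract gauss_mult pos_divide_le_eq)
qed

sublocale GF: nonarch_absolute_value GF
  by unfold_locales (rule nonarch_GF)

end

text \<open>Maximality of the Gauss norm: the ultrametric inequality bounds a sum by its largest
  term, and \<open>N\<close> is multiplicative on monomials.\<close>

lemma (in laurent_evaluation) eval_norm_le:
  fixes N :: "'f \<Rightarrow> real" and v :: "'k \<Rightarrow> real"
  assumes "nonarch_abs N" and "\<And>x. N (c x) = v x" 
  shows "N (eval f) \<le> gauss_norm v (\<lambda>i. N (h i)) f"
proof -
  interpret N: nonarch_absolute_value N
    by unfold_locales (rule assms)
  let ?w = "\<lambda>\<alpha>. v (Poly_Mapping.lookup f \<alpha>) * laurent_monomial (\<lambda>i. N (h i)) \<alpha>"
  have "?w \<alpha> \<le> gauss_norm v (\<lambda>i. N (h i)) f" if "\<alpha> \<in> Poly_Mapping.keys f" for \<alpha>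
    unfolding gauss_norm_def using that by (intro Max_ge) auto
  moreover have "0 \<le> gauss_norm v (\<lambda>i. N (h i)) f"
    unfolding gauss_norm_def by (intro Max_ge) auto
  ultimately show ?thesis
    unfolding eval_def by (intro N.sum_le) (auto simp: N.mult N.laurent_monomial assms)
qed

section \<open>Gauss norms attached to ultrametrics\<close>

text \<open>Entries are logarithms of distances, so they may be negative, and row \<open>n\<close>
  vanishes because p_kn = 1. Distinctness keeps out singletons {i,i}, where vectors in
  \<open>Mdual n\<close> carry no information.\<close>

definition ultrametrics :: "nat \<Rightarrow> (nat set \<Rightarrow> real) set" where
  "ultrametrics n = {x \<in> Mdual n. (\<forall>k\<in>{1..<n}. x {k, n} = 0) \<and>
     (\<forall>i\<in>{1..<n}. \<forall>j\<in>{1..<n}. \<forall>k\<in>{1..<n}.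
        i \<noteq> j \<and> j \<noteq> k \<and> i \<noteq> k \<longrightarrow> x {i, j} \<le> max (x {i, k}) (x {j, k}))}"

text \<open>Index 1 is the root. Extensionality makes the set finite, as the closed cover
  requires.\<close>

definition parent_maps :: "nat \<Rightarrow> (nat \<Rightarrow> nat) set" where
  "parent_maps n = (\<Pi>\<^sub>E k\<in>{2..<n}. {1..<k})"

definition nearest :: "nat \<Rightarrow> (nat set \<Rightarrow> real) \<Rightarrow> (nat \<Rightarrow> nat) \<Rightarrow> bool" where
  "nearest n x p \<longleftrightarrow> (\<forall>k\<in>{2..<n}. \<forall>l\<in>{1..<k}. x {k, p k} \<le> x {k, l})"

type_synonym 'k coord_ring = "(nat \<Rightarrow>\<^sub>0 int) \<Rightarrow>\<^sub>0 'k"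

definition coord :: "nat \<Rightarrow> 'k::field coord_ring" where
  "coord k = Poly_Mapping.single (Poly_Mapping.single k 1) 1"

text \<open>
  \<open>point p k\<close> is \<open>z\<^sub>k\<close> in the coordinates \<open>w\<^sub>k = z\<^sub>k - z\<^bsub>p k\<^esub>\<close>, normalized by \<open>z\<^sub>1 = 0\<close>.
\<close>

function point :: "(nat \<Rightarrow> nat) \<Rightarrow> nat \<Rightarrow> 'k::field coord_ring" where
  "point p k = (if 1 \<le> p k \<and> p k < k then point p (p k) + coord k else 0)"
  by auto
termination
  by (relation "inv_image less_than snd") auto

declare point.simps [simp del]

text \<open>
  The value \<open>1\<close> covers \<open>p\<^sub>k\<^sub>n = 1\<close> and also junk indices, whose values have to be units.
\<close>

definition plucker_value :: "nat \<Rightarrow> (nat \<Rightarrow> nat) \<Rightarrow> nat set \<Rightarrow> 'k::field coord_ring" where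
  "plucker_value n p e = (if e \<in> nsets {1..<n} 2 then point p (Max e) - point p (Min e) else 1)"

text \<open>The value 1 outside \<open>{2..<n}\<close> keeps every radius positive, as the locale
  \<open>gauss\<close> demands.\<close>

definition radius :: "nat \<Rightarrow> (nat \<Rightarrow> nat) \<Rightarrow> (nat set \<Rightarrow> real) \<Rightarrow> nat \<Rightarrow> real" where
  "radius n p x k = (if k \<in> {2..<n} then exp (x {k, p k}) else 1)"

lemma radius_pos: "0 < radius n p x k"
  by (simp add: radius_def)

definition const_fract :: "'k::field \<Rightarrow> 'k coord_ring fract" where
  "const_fract a = Fract (Poly_Mapping.single 0 a) 1"

text \<open>The target is a fraction field because z_l - z_k need not be a Laurent monomial in the
  coordinates, while negative powers of p_kl have to be evaluated.\<close>

definition plucker_eval :: "nat \<Rightarrow> (nat \<Rightarrow> nat) \<Rightarrow> 'k::field laurent \<Rightarrow> 'k coord_ring fract" where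
  "plucker_eval n p = laurent_evaluation.eval const_fract (\<lambda>e. Fract (plucker_value n p e) 1)"

definition coord_norm ::
  "('k::field \<Rightarrow> real) \<Rightarrow> nat \<Rightarrow> (nat \<Rightarrow> nat) \<Rightarrow> (nat set \<Rightarrow> real) \<Rightarrow> 'k coord_ring fract \<Rightarrow> real" where
  "coord_norm v n p x = fract_norm (gauss_norm v (radius n p x))"

lemma in_pairs_iff: "e \<in> pairs n \<longleftrightarrow> (\<exists>k l. e = {k, l} \<and> 1 \<le> k \<and> k < l \<and> l \<le> n)"
proof
  assume "e \<in> pairs n"
  then obtain k l where "e = {k, l}" "k \<noteq> l" "k \<in> {1..n}" "l \<in> {1..n}"
    by (auto simp: nsets_def card_2_iff)
  then show "\<exists>k l. e = {k, l} \<and> 1 \<le> k \<and> k < l \<and> l \<le> n"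
    by (cases "k < l") (auto simp: doubleton_eq_iff intro: exI[of _ l])
qed (auto simp: nsets_def)

lemma plucker_value_pair:
  assumes "1 \<le> k" "k < l" "l < n"
  shows "plucker_value n p {k, l} = point p l - point p k"
  using assms by (auto simp: plucker_value_def nsets_def max_def min_def)

lemma plucker_value_n [simp]: "plucker_value n p {k, n} = 1"
  by (auto simp: plucker_value_def nsets_def)

lemma plucker_value_outside: "e \<notin> pairs n \<Longrightarrow> plucker_value n p e = 1"
  by (auto simp: plucker_value_def nsets_def subset_iff)

lemma parent_less:
  assumes "p \<in> parent_maps n" "k \<in> {2..<n}"
  shows "1 \<le> p k" "p k < k"
  using assms by (force simp: parent_maps_def PiE_def Pi_def)+

text \<open>The guard of the recursion fails at 1 whatever \<open>p 1\<close> is, so the root sits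
  at the origin.\<close>

lemma point_1 [simp]: "point p (Suc 0) = 0"
  by (subst point.simps) (simp only: One_nat_def, auto)

lemma point_parent:
  assumes "p \<in> parent_maps n" "k \<in> {2..<n}"
  shows "point p k = point p (p k) + coord k"
  using parent_less[OF assms] by (subst point.simps) simp

text \<open>Earlier points involve earlier coordinates only, so \<open>coord k\<close> is a fresh
  variable when it is added to \<open>point p (p k)\<close>.\<close>

lemma keys_point:
  "Poly_Mapping.keys (point p k :: 'k::field coord_ring) \<subseteq> (\<lambda>i. Poly_Mapping.single i 1) ` {..k}"
proof (induction k rule: less_induct)
  case (less k)
  show ?case
  proof (cases "1 \<le> p k \<and> p k < k")
    case True
    then have "point p k = point p (p k) + (coord k :: 'k coord_ring)"
      by (subst point.simps) simp
    then have "Poly_Mapping.keys (point p k :: 'k coord_ring)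
        \<subseteq> Poly_Mapping.keys (point p (p k) :: 'k coord_ring) \<union> {Poly_Mapping.single k 1}"
      using Poly_Mapping.keys_add[of "point p (p k) :: 'k coord_ring" "coord k"] by (simp add: coord_def)
    also have "\<dots> \<subseteq> (\<lambda>i. Poly_Mapping.single i 1) ` {..k}"
      using less[of "p k"] True by fastforce
    finally show ?thesis .
  next
    case False
    then have "point p k = (0 :: 'k coord_ring)"
      by (subst point.simps) auto
    then show ?thesis
      by simp
  qed
qed

section \<open>Distances and Pluecker relations in the coordinates of one choice of nearest
  points\<close>

locale tree = nonarch_absolute_value v for v :: "'k::field \<Rightarrow> real" +
  fixes n :: nat and x :: "nat set \<Rightarrow> real" and p :: "nat \<Rightarrow> nat"
  assumes ultrametric: "x \<in> ultrametrics n"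
    and parent: "p \<in> parent_maps n"
    and near: "nearest n x p"
begin

sublocale gauss v "radius n p x"
  by unfold_locales (rule radius_pos)

lemma gauss_coord: "gauss_norm v (radius n p x) (coord k) = radius n p x k"
  by (simp add: coord_def)

text \<open>The difference is \<open>coord k\<close> plus the difference of
  \<open>point p (p k)\<close> and \<open>point p l\<close>. The fresh variable rules out
  cancellation, so the norm is a maximum of two known numbers, and the ultrametric inequality
  identifies that maximum.\<close>

lemma gauss_point_diff:
  assumes "1 \<le> l" "l < k" "k < n"
  shows "gauss_norm v (radius n p x) (point p k - point p l) = exp (x {k, l})"
  using assms
proof (induction k arbitrary: l rule: less_induct)
  case (less k)
  have k: "k \<in> {2..<n}"
    using less.prems by auto
  note pk = parent_less[OF parent k]
  let ?q = "point p (p k) - point p l :: 'k coord_ring"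
  have "Poly_Mapping.keys ?q \<subseteq> (\<lambda>i. Poly_Mapping.single i 1) ` {..<k}"
    using keys_diff[of "point p (p k) :: 'k coord_ring" "point p l"] less.prems pk
      keys_point[of p "p k", where 'k='k] keys_point[of p l, where 'k='k]
    by fastforce
  then have "Poly_Mapping.keys (coord k :: 'k coord_ring) \<inter> Poly_Mapping.keys ?q = {}"
    by (auto simp: coord_def frag_of_eq)
  then have "G (coord k + ?q) = max (radius n p x k) (G ?q)"
    by (simp add: gauss_add_disjoint gauss_coord)
  then have *: "G (point p k - point p l) = max (exp (x {k, p k})) (G ?q)"
    using k by (simp add: point_parent[OF parent k] radius_def algebra_simps)
  have near_k: "x {k, p k} \<le> x {k, l}"
    using near k less.prems by (simp add: nearest_def)
  have tri: "x {i, j} \<le> max (x {i, m}) (x {j, m})"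
    if "i \<in> {1..<n}" "j \<in> {1..<n}" "m \<in> {1..<n}" "i \<noteq> j" "j \<noteq> m" "i \<noteq> m" for i j m
    using ultrametric that by (simp add: ultrametrics_def)
  show ?case
  proof (cases "p k = l")
    case False
    have "G ?q = exp (x {p k, l})"
    \<comment> \<open>The induction hypothesis wants the larger index first. Both indices are below
      \<open>k\<close>, and swapping them only changes a sign.\<close>
    proof (cases "l < p k")
      case True
      then show ?thesis
        using less.IH[OF pk(2), of l] less.prems pk by simp
    next
      case False
      with \<open>p k \<noteq> l\<close> have "p k < l"
        by simp
      then have "G (point p l - point p (p k)) = exp (x {l, p k})"
        using less.IH[of l "p k"] less.prems pk by simp
      then show ?thesis
        using gauss_uminus[of ?q] by (simp add: insert_commute)
    qed
    \<comment> \<open>The inequality at \<open>k\<close>, \<open>l\<close> gives the upper bound.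
      For the lower bound, nearness gives \<open>x {k, p k} \<le> x {k, l}\<close>, and the
      inequality at \<open>p k\<close>, \<open>l\<close> then bounds \<open>x {p k, l}\<close> by
      \<open>x {k, l}\<close> as well.\<close>
    moreover have "x {k, l} = max (x {k, p k}) (x {p k, l})"
      using tri[of k l "p k"] tri[of "p k" l k] near_k less.prems pk False
      by (auto simp: insert_commute max_def split: if_splits)
    ultimately show ?thesis
      using * by (simp add: max_def)
  qed (simp add: *)
qed

lemma gauss_plucker_value:
  "gauss_norm v (radius n p x) (plucker_value n p e) = (if e \<in> pairs n then exp (x e) else 1)"
proof (cases "e \<in> pairs n")
  case True
  then obtain k l where e: "e = {k, l}" "1 \<le> k" "k < l" "l \<le> n"
    unfolding in_pairs_iff by blast
  show ?thesis
  proof (cases "l = n")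
    case True
    with e ultrametric show ?thesis
      by (auto simp: ultrametrics_def)
  next
    case False
    with e have "G (plucker_value n p e) = exp (x {l, k})"
      by (simp add: plucker_value_pair gauss_point_diff)
    with True e show ?thesis
      by (simp add: insert_commute)
  qed
qed (simp add: plucker_value_outside)

lemma plucker_value_nonzero: "plucker_value n p e \<noteq> (0 :: 'k coord_ring)"
  using gauss_plucker_value[of e] by (auto split: if_splits)

sublocale pl: laurent_evaluation
  "const_fract :: 'k \<Rightarrow> 'k coord_ring fract" "\<lambda>e. Fract (plucker_value n p e) 1"
  rewrites "laurent_evaluation.eval const_fract (\<lambda>e. Fract (plucker_value n p e) 1)
    = (plucker_eval n p :: 'k laurent \<Rightarrow> _)"
proof -
  show "laurent_evaluation (const_fract :: 'k \<Rightarrow> 'k coord_ring fract) (\<lambda>e. Fract (plucker_value n p e) 1)"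
    by unfold_locales
      (auto simp: const_fract_def single_add mult_single Zero_fract_def One_fract_def eq_fract
        plucker_value_nonzero)
qed (simp add: plucker_eval_def)

sublocale cn: nonarch_absolute_value "coord_norm v n p x"
  by unfold_locales (simp add: coord_norm_def nonarch_GF)

lemma coord_norm_Fract_1 [simp]: "coord_norm v n p x (Fract a 1) = gauss_norm v (radius n p x) a"
  by (simp add: coord_norm_def GF_Fract)

lemma coord_norm_const [simp]: "coord_norm v n p x (const_fract a) = v a"
  by (simp add: const_fract_def)

lemma coord_norm_monomial:
  "coord_norm v n p x (plucker_eval n p (Poly_Mapping.single \<alpha> a)) =
     v a * laurent_monomial (\<lambda>e. if e \<in> pairs n then exp (x e) else 1) \<alpha>"
  by (simp add: cn.mult cn.laurent_monomial gauss_plucker_value)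

lemma plucker_eval_var: 
  "plucker_eval n p (plucker_var k l :: 'k laurent) = Fract (plucker_value n p {k, l}) 1"
  using pl.c_1 by (simp add: plucker_var_def unit_expo_def)

text \<open>For \<open>l < n\<close> this is the classical identity between products of differences.
  For \<open>l = n\<close> it becomes linear: (z_j - z_i) - (z_k - z_i) + (z_k - z_j) = 0.\<close>

lemma plucker_eval_relation:
  assumes "f \<in> plucker_relations n"
  shows "plucker_eval n p (f :: 'k laurent) = 0"
proof -
  obtain i j k l where f: "f = plucker_var i j * plucker_var k l - plucker_var i k * plucker_var j l
        + plucker_var i l * plucker_var j k" and *: "1 \<le> i" "i < j" "j < k" "k < l" "l \<le> n"
    using assms by (auto simp: plucker_relations_def)
  show ?thesis
  proof (cases "l = n")
    case True
    with * show ?thesis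
      by (simp add: f pl.eval_add pl.eval_diff pl.eval_mult plucker_eval_var plucker_value_pair
        Zero_fract_def eq_fract)
  next
    case False
    with * show ?thesis
      by (simp add: f pl.eval_add pl.eval_diff pl.eval_mult plucker_eval_var plucker_value_pair
        Zero_fract_def eq_fract algebra_simps)
  qed
qed

end

section \<open>Independence of the choice of nearest points\<close>

locale two_trees = tree v n x p + q: tree v n x q
  for v :: "'k::field \<Rightarrow> real" and n x p q
begin

text \<open>The coordinate \<open>w\<^sub>k\<close> of \<open>p\<close>, written in the coordinates of \<open>q\<close>.\<close>

definition coord_change :: "nat \<Rightarrow> 'k coord_ring fract" where
  "coord_change k = Fract (if k \<in> {2..<n} then point q k - point q (p k) else coord k) 1"

text \<open>Distances between points are the same in the coordinates of \<open>q\<close>, so the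
  distance from \<open>k\<close> to \<open>p k\<close> is the radius that \<open>p\<close>
  prescribes. Hence the norm of \<open>q\<close> competes with the Gauss norm of \<open>p\<close>
  under the same values on coordinates.\<close>

lemma norm_coord_change: "coord_norm v n q x (coord_change k) = radius n p x k"
proof (cases "k \<in> {2..<n}")
  case True
  then show ?thesis
    using parent_less[OF parent True] q.gauss_point_diff[of "p k" k] by (simp add: coord_change_def radius_def)
next
  case False
  then have "radius n q x k = radius n p x k"
    by (simp add: radius_def del: atLeastLessThan_iff)
  then show ?thesis
    by (simp add: coord_change_def if_not_P[OF False] q.gauss_coord del: atLeastLessThan_iff)
qed

sublocale sub: laurent_evaluation "const_fract :: 'k \<Rightarrow> 'k coord_ring fract" coord_change
proof unfold_locales
  fix k show "coord_change k \<noteq> 0"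
    using norm_coord_change[of k] radius_pos[of n p x k] by auto
qed (auto simp: pl.c_add pl.c_mult)

lemma eval_coord: "sub.eval (coord k) = coord_change k"
  by (simp add: coord_def del: pl.c_1) (simp add: pl.c_1)

lemma eval_point: "1 \<le> k \<Longrightarrow> k < n \<Longrightarrow> sub.eval (point p k) = Fract (point q k) 1"
proof (induction k rule: less_induct)
  case (less k)
  show ?case
  proof (cases "k = 1")
    case False
    then have k: "k \<in> {2..<n}"
      using less.prems by auto
    note pk = parent_less[OF parent k]
    have "sub.eval (point p k) = Fract (point q (p k)) 1 + coord_change k"
      using less.IH[of "p k"] pk less.prems
      by (simp add: point_parent[OF parent k] sub.eval_add eval_coord)
    moreover have "coord_change k = Fract (point q k - point q (p k)) 1"
      using k by (simp add: coord_change_def)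
    ultimately show ?thesis
      by simp
  qed (simp add: Zero_fract_def)
qed

lemma eval_plucker_value: "sub.eval (plucker_value n p e) = Fract (plucker_value n q e) 1"
proof (cases "e \<in> nsets {1..<n} 2")
  case True
  then obtain k l where "e = {k, l}" "k \<in> {1..<n}" "l \<in> {1..<n}" "k \<noteq> l"
    by (auto simp: nsets_def card_2_iff)
  then show ?thesis
    by (auto simp: plucker_value_def sub.eval_diff eval_point max_def min_def)
qed (auto simp: plucker_value_def One_fract_def)

text \<open>Maximality of the Gauss norm of \<open>p\<close>, applied to the norm of
  \<open>q\<close> composed with the substitution. It is only an inequality, so denominators need
  separate control.\<close>

lemma norm_eval_le: "coord_norm v n q x (sub.eval f) \<le> gauss_norm v (radius n p x) f"
  using sub.eval_norm_le[OF q.cn.nonarch, of v f] by (simp add: norm_coord_change)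

text \<open>
  \<open>compat a b\<close> says that \<open>b\<close> arises from \<open>a\<close> by the change of coordinates, which preserves the
  norm of some denominator of \<open>a\<close>. That is the case for the Pluecker coordinates, the only
  denominators that occur.
\<close>

definition compat :: "'k coord_ring fract \<Rightarrow> 'k coord_ring fract \<Rightarrow> bool" where
  "compat a b \<longleftrightarrow> (\<exists>f d. d \<noteq> 0 \<and>
     coord_norm v n q x (sub.eval d) = gauss_norm v (radius n p x) d \<and>
     a * Fract d 1 = Fract f 1 \<and> b * sub.eval d = sub.eval f)"

lemma compat_eval: "compat (Fract f 1) (sub.eval f)"
  unfolding compat_def by (rule exI[of _ f], rule exI[of _ 1]) simp

lemma compat_add: 
  assumes "compat a b" "compat a' b'"
  shows "compat (a + a') (b + b')"
proof -
  obtain f d where d: "d \<noteq> 0" "coord_norm v n q x (sub.eval d) = G d"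
    "a * Fract d 1 = Fract f 1" "b * sub.eval d = sub.eval f"
    using assms(1) by (auto simp: compat_def)
  obtain f' d' where d': "d' \<noteq> 0" "coord_norm v n q x (sub.eval d') = G d'"
    "a' * Fract d' 1 = Fract f' 1" "b' * sub.eval d' = sub.eval f'"
    using assms(2) by (auto simp: compat_def)
  have "(a + a') * Fract (d * d') 1 = a * Fract d 1 * Fract d' 1 + a' * Fract d' 1 * Fract d 1"
    by (simp add: algebra_simps)
  also have "\<dots> = Fract (f * d' + f' * d) 1"
    by (simp add: d d')
  finally have 1: "(a + a') * Fract (d * d') 1 = Fract (f * d' + f' * d) 1" .
  have "(b + b') * sub.eval (d * d') = b * sub.eval d * sub.eval d' + b' * sub.eval d' * sub.eval d"
    by (simp add: sub.eval_mult algebra_simps)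
  also have "\<dots> = sub.eval (f * d' + f' * d)"
    by (simp add: d d' sub.eval_mult sub.eval_add)
  finally show ?thesis
    using 1 d d' unfolding compat_def
    by (intro exI[of _ "f * d' + f' * d"] exI[of _ "d * d'"])
      (simp add: sub.eval_mult q.cn.mult gauss_mult)
qed

lemma compat_mult:
  assumes "compat a b" "compat a' b'"
  shows "compat (a * a') (b * b')"
proof -
  obtain f d where d: "d \<noteq> 0" "coord_norm v n q x (sub.eval d) = G d"
    "a * Fract d 1 = Fract f 1" "b * sub.eval d = sub.eval f"
    using assms(1) by (auto simp: compat_def)
  obtain f' d' where d': "d' \<noteq> 0" "coord_norm v n q x (sub.eval d') = G d'"
    "a' * Fract d' 1 = Fract f' 1" "b' * sub.eval d' = sub.eval f'"
    using assms(2) by (auto simp: compat_def)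
  have "Fract (d * d') 1 = Fract d 1 * Fract d' 1"
    by simp
  then have "(a * a') * Fract (d * d') 1 = (a * Fract d 1) * (a' * Fract d' 1)"
    by (simp only: mult_ac)
  also have "\<dots> = Fract (f * f') 1"
    by (simp add: d d')
  finally have 1: "(a * a') * Fract (d * d') 1 = Fract (f * f') 1" .
  have "(b * b') * sub.eval (d * d') = (b * sub.eval d) * (b' * sub.eval d')"
    by (simp add: sub.eval_mult mult_ac)
  also have "\<dots> = sub.eval (f * f')"
    by (simp add: d d' sub.eval_mult)
  finally show ?thesis
    using 1 d d' unfolding compat_def
    by (intro exI[of _ "f * f'"] exI[of _ "d * d'"])
      (simp add: sub.eval_mult q.cn.mult gauss_mult)
qed

lemma compat_0: "compat 0 0"
  using compat_eval[of 0] by (simp add: Zero_fract_def)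

lemma compat_1: "compat 1 1"
  using compat_eval[of 1] by (simp add: One_fract_def)

lemma compat_const: "compat (const_fract a) (const_fract a)"
  using compat_eval[of "Poly_Mapping.single 0 a"] by (simp add: const_fract_def)

lemma compat_sum: "(\<And>a. a \<in> A \<Longrightarrow> compat (f a) (g a)) \<Longrightarrow> compat (sum f A) (sum g A)"
  by (induction A rule: infinite_finite_induct) (auto simp: compat_0 compat_add)

lemma compat_prod: "(\<And>a. a \<in> A \<Longrightarrow> compat (f a) (g a)) \<Longrightarrow> compat (prod f A) (prod g A)"
  by (induction A rule: infinite_finite_induct) (auto simp: compat_1 compat_mult)

lemma compat_power: "compat a b \<Longrightarrow> compat (a ^ m) (b ^ m)"
  by (induction m) (auto simp: compat_1 compat_mult)

lemma compat_plucker_value: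
  "compat (Fract (plucker_value n p e) 1) (Fract (plucker_value n q e) 1)"
  using compat_eval[of "plucker_value n p e"] by (simp add: eval_plucker_value)

text \<open>Nontrivial denominators enter here. Their norm is preserved because a Pluecker value has
  norm \<open>exp (x e)\<close>, or 1 at junk indices, in both systems.\<close>

lemma compat_inverse_plucker_value:
  "compat (inverse (Fract (plucker_value n p e) 1)) (inverse (Fract (plucker_value n q e) 1))"
  unfolding compat_def
  by (rule exI[of _ 1], rule exI[of _ "plucker_value n p e"])
    (simp add: plucker_value_nonzero q.plucker_value_nonzero eval_plucker_value
      gauss_plucker_value q.gauss_plucker_value One_fract_def eq_fract)

lemma compat_power_int_plucker_value:
  "compat (Fract (plucker_value n p e) 1 powi m) (Fract (plucker_value n q e) 1 powi m)"
  unfolding power_int_def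
  using compat_power[OF compat_plucker_value] compat_power[OF compat_inverse_plucker_value] by simp

lemma compat_plucker_eval: "compat (plucker_eval n p f) (plucker_eval n q f)"
  unfolding pl.eval_def q.pl.eval_def laurent_monomial_def
  by (intro compat_sum compat_mult compat_prod compat_const compat_power_int_plucker_value)

text \<open>After clearing the denominator \<open>d\<close> the numerators compare by
  \<open>norm_eval_le\<close>. Both sides carry the same positive factor, the norm of
  \<open>d\<close>, which cancels.\<close>

lemma coord_norm_plucker_eval_le:
  "coord_norm v n q x (plucker_eval n q f) \<le> coord_norm v n p x (plucker_eval n p f)"
proof -
  let ?a = "plucker_eval n p f" and ?b = "plucker_eval n q f"
  obtain g d where d: "d \<noteq> 0" "coord_norm v n q x (sub.eval d) = G d"
    "?a * Fract d 1 = Fract g 1" "?b * sub.eval d = sub.eval g"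
    using compat_plucker_eval[of f] unfolding compat_def by blast
  have "coord_norm v n q x ?b * G d = coord_norm v n q x (sub.eval g)"
    by (simp only: q.cn.mult d(2) flip: d(4))
  also have "\<dots> \<le> coord_norm v n p x (?a * Fract d 1)"
    by (simp add: norm_eval_le d(3))
  also have "\<dots> = coord_norm v n p x ?a * G d"
    by (simp add: cn.mult)
  finally show ?thesis
    using gauss_pos[OF d(1)] by simp
qed

end

lemma coord_norm_plucker_eval_eq:
  assumes "tree v n x p" "tree v n x q"
  shows "coord_norm v n p x (plucker_eval n p f) = coord_norm v n q x (plucker_eval n q f)"
  by (intro antisym two_trees.coord_norm_plucker_eval_le two_trees.intro assms)

section \<open>Continuous dependence on the ultrametric\<close>

definition nearest_parent :: "nat \<Rightarrow> (nat set \<Rightarrow> real) \<Rightarrow> nat \<Rightarrow> nat" where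
  "nearest_parent n x = (SOME p. p \<in> parent_maps n \<and> nearest n x p)"

lemma nearest_parent:
  "nearest_parent n x \<in> parent_maps n \<and> nearest n x (nearest_parent n x)"
proof -
  define p where "p = (\<lambda>k\<in>{2..<n}. arg_min_on (\<lambda>l. x {k, l}) {1..<k})"
  have "p k \<in> {1..<k} \<and> (\<forall>l\<in>{1..<k}. x {k, p k} \<le> x {k, l})" if "k \<in> {2..<n}" for k
    using that arg_min_if_finite(1)[of "{1..<k}" "\<lambda>l. x {k, l}"]
      arg_min_least[of "{1..<k}" _ "\<lambda>l. x {k, l}"]
    by (auto simp: p_def)
  then have "p \<in> parent_maps n \<and> nearest n x p"
    by (auto simp: parent_maps_def nearest_def p_def)
  then show ?thesis
    unfolding nearest_parent_def by (rule someI[where x = p])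
qed

text \<open>The chosen parent map may jump with \<open>x\<close>; by
  \<open>coord_norm_plucker_eval_eq\<close> the value does not notice on ultrametrics.\<close>

definition tree_norm ::
  "('k::field \<Rightarrow> real) \<Rightarrow> nat \<Rightarrow> (nat set \<Rightarrow> real) \<Rightarrow> 'k laurent \<Rightarrow> real" where
  "tree_norm v n x f =
     coord_norm v n (nearest_parent n x) x (plucker_eval n (nearest_parent n x) f)"

lemma continuous_map_Max:
  assumes "finite A" and "\<And>a. a \<in> A \<Longrightarrow> continuous_map X euclideanreal (f a)"
  shows "continuous_map X euclideanreal (\<lambda>x. Max (insert 0 ((\<lambda>a. f a x) ` A)))"
  using assms
proof (induction A rule: finite_induct)
  case (insert a A)
  have "Max (insert 0 ((\<lambda>a. f a x) ` insert a A)) = max (f a x) (Max (insert 0 ((\<lambda>a. f a x) ` A)))"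
    for x
    using insert.hyps by (simp add: insert_commute[of 0])
  then show ?case
    using insert by (simp add: continuous_map_real_max)
qed simp

lemma exp_power_int: "exp (y::real) powi m = exp (of_int m * y)"
  by (cases m rule: int_cases2) (auto simp: power_int_minus exp_minus exp_of_nat_mult)

lemma continuous_map_coordinate:
  "e \<in> pairs n \<Longrightarrow> continuous_map (Mdual_topology n) euclideanreal (\<lambda>x. x e)"
  unfolding Mdual_topology_def by (rule continuous_map_product_projection)

lemma continuous_map_radius_power_int:
  assumes "p \<in> parent_maps n"
  shows "continuous_map (Mdual_topology n) euclideanreal (\<lambda>x. radius n p x k powi m)"
proof (cases "k \<in> {2..<n}")
  case True
  then have "continuous_map (Mdual_topology n) euclideanreal (\<lambda>x. of_int m * x {k, p k})"
    using parent_less[OF assms True]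
    by (intro continuous_map_real_mult continuous_map_coordinate) auto
  then have "continuous_map (Mdual_topology n) euclideanreal (exp \<circ> (\<lambda>x. of_int m * x {k, p k}))"
    by (rule continuous_map_compose) (simp add: continuous_on_exp)
  with True show ?thesis
    by (simp add: radius_def exp_power_int o_def)
qed (auto simp: radius_def)

lemma continuous_map_gauss_norm:
  assumes "p \<in> parent_maps n"
  shows "continuous_map (Mdual_topology n) euclideanreal (\<lambda>x. gauss_norm v (radius n p x) f)"
  unfolding gauss_norm_def laurent_monomial_def
  by (intro continuous_map_Max continuous_map_real_mult continuous_map_prod
      continuous_map_radius_power_int assms) auto

text \<open>One representation of the fraction serves all \<open>x\<close>, and the norm of its
  denominator never vanishes.\<close>

lemma (in nonarch_absolute_value) continuous_map_coord_norm:
  assumes "p \<in> parent_maps n"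
  shows "continuous_map (Mdual_topology n) euclideanreal (\<lambda>x. coord_norm v n p x q)"
proof -
  obtain a b where q: "q = Fract a b" "b \<noteq> 0"
    by (cases q)
  have g: "gauss v (radius n p x)" for x
    by unfold_locales (rule radius_pos)
  have "coord_norm v n p x q = gauss_norm v (radius n p x) a / gauss_norm v (radius n p x) b" for x
    unfolding coord_norm_def q by (rule gauss.GF_Fract[OF g q(2)])
  moreover have "gauss_norm v (radius n p x) b \<noteq> 0" for x
    by (simp add: gauss.gauss_eq_0_iff[OF g] q(2))
  ultimately show ?thesis
    by (simp add: continuous_map_real_divide continuous_map_gauss_norm assms)
qed

lemma (in nonarch_absolute_value) tree_nearest_parent:
  "x \<in> ultrametrics n \<Longrightarrow> tree v n x (nearest_parent n x)"
  using nearest_parent[of n x] by unfold_locales auto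

lemma finite_parent_maps: "finite (parent_maps n)"
  unfolding parent_maps_def by (intro finite_PiE) auto

lemma (in nonarch_absolute_value) continuous_map_tree_norm:
  "continuous_map (subtopology (Mdual_topology n) (ultrametrics n)) euclideanreal
     (\<lambda>x. tree_norm v n x f)"
proof (rule pasting_lemma_closed[OF finite_parent_maps])
  let ?X = "subtopology (Mdual_topology n) (ultrametrics n)"
  let ?T = "\<lambda>p. {x \<in> topspace ?X. nearest n x p}"
  fix p assume p: "p \<in> parent_maps n"
  let ?C = "\<lambda>(k, l). {x \<in> topspace ?X. x {k, p k} - x {k, l} \<in> {..0}}"
  \<comment> \<open>Inserting the whole space keeps the family nonempty when \<open>{2..<n}\<close>
    is empty.\<close>
  have *: "?T p = \<Inter>(insert (topspace ?X) (?C ` Sigma {2..<n} (\<lambda>k. {1..<k})))"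
    by (auto simp: nearest_def)
  show "closedin ?X (?T p)"
    unfolding *
  proof (intro closedin_Inter)
    fix S assume "S \<in> insert (topspace ?X) (?C ` Sigma {2..<n} (\<lambda>k. {1..<k}))"
    then consider "S = topspace ?X" | k l where "S = ?C (k, l)" "k \<in> {2..<n}" "l \<in> {1..<k}"
      by blast
    then show "closedin ?X S"
    proof cases
      case (2 k l)
      have "continuous_map ?X euclideanreal (\<lambda>x. x {k, p k} - x {k, l})"
        using parent_less[OF p 2(2)] 2
        by (intro continuous_map_diff continuous_map_from_subtopology continuous_map_coordinate) auto
      then have "closedin ?X {x \<in> topspace ?X. x {k, p k} - x {k, l} \<in> {..0}}"
        by (rule closedin_continuous_map_preimage) simp
      then show ?thesis
        by (simp add: 2)
    qed (simp only: closedin_topspace)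
  qed simp
  show "continuous_map (subtopology ?X (?T p)) euclideanreal
      (\<lambda>x. coord_norm v n p x (plucker_eval n p f))"
    by (intro continuous_map_from_subtopology continuous_map_coord_norm p)
next
  let ?X = "subtopology (Mdual_topology n) (ultrametrics n)"
  let ?T = "\<lambda>p. {x \<in> topspace ?X. nearest n x p}"
  fix p q x
  assume "p \<in> parent_maps n" "q \<in> parent_maps n" "x \<in> topspace ?X \<inter> ?T p \<inter> ?T q"
  then show "coord_norm v n p x (plucker_eval n p f) = coord_norm v n q x (plucker_eval n q f)"
    by (intro coord_norm_plucker_eval_eq; unfold_locales) auto
next
  let ?X = "subtopology (Mdual_topology n) (ultrametrics n)"
  let ?T = "\<lambda>p. {x \<in> topspace ?X. nearest n x p}"
  fix x assume "x \<in> topspace ?X"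
  then show "\<exists>p. p \<in> parent_maps n \<and> x \<in> ?T p \<and>
      tree_norm v n x f = coord_norm v n p x (plucker_eval n p f)"
    using nearest_parent[of n x] unfolding tree_norm_def by blast
qed

section \<open>The ring of torus invariants\<close>

lemma expo_lattice_0 [simp]: "0 \<in> expo_lattice n"
  and expo_lattice_add: "\<alpha> \<in> expo_lattice n \<Longrightarrow> \<beta> \<in> expo_lattice n \<Longrightarrow> \<alpha> + \<beta> \<in> expo_lattice n"
  using Poly_Mapping.keys_add[of \<alpha> \<beta>] by (auto simp: expo_lattice_def)

lemma carrier_laurent_ring: "carrier (laurent_ring n) = {f. Poly_Mapping.keys f \<subseteq> expo_lattice n}"
  by (simp add: laurent_ring_def)

lemma laurent_ring_ops [simp]:
  "mult (laurent_ring n) = (*)" "one (laurent_ring n) = 1"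
  "ring.zero (laurent_ring n) = 0" "add (laurent_ring n) = (+)"
  by (auto simp: laurent_ring_def)

lemma carrier_closed:
  fixes f g :: "'k::field laurent"
  shows "(0 :: 'k laurent) \<in> carrier (laurent_ring n)" "(1 :: 'k laurent) \<in> carrier (laurent_ring n)"
    and "f \<in> carrier (laurent_ring n) \<Longrightarrow> g \<in> carrier (laurent_ring n) \<Longrightarrow> f + g \<in> carrier (laurent_ring n)"
    and "f \<in> carrier (laurent_ring n) \<Longrightarrow> g \<in> carrier (laurent_ring n) \<Longrightarrow> f * g \<in> carrier (laurent_ring n)"
    and "f \<in> carrier (laurent_ring n) \<Longrightarrow> - f \<in> carrier (laurent_ring n)"
    and "f \<in> carrier (laurent_ring n) \<Longrightarrow> g \<in> carrier (laurent_ring n) \<Longrightarrow> f - g \<in> carrier (laurent_ring n)"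
proof -
  have uminus: "Poly_Mapping.keys (- g) = Poly_Mapping.keys g" for g :: "'k laurent"
    by (auto simp: in_keys_iff)
  have add: "Poly_Mapping.keys (f + g) \<subseteq> expo_lattice n"
    if "Poly_Mapping.keys f \<subseteq> expo_lattice n" "Poly_Mapping.keys g \<subseteq> expo_lattice n" for f g :: "'k laurent"
    using that Poly_Mapping.keys_add[of f g] by blast
  show "f + g \<in> carrier (laurent_ring n)" if "f \<in> carrier (laurent_ring n)" "g \<in> carrier (laurent_ring n)"
    using that add by (simp add: carrier_laurent_ring)
  show "- f \<in> carrier (laurent_ring n)" if "f \<in> carrier (laurent_ring n)"
    using that by (simp add: carrier_laurent_ring uminus)
  show "f - g \<in> carrier (laurent_ring n)" if "f \<in> carrier (laurent_ring n)" "g \<in> carrier (laurent_ring n)"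
    using that add[of f "- g"] by (simp add: carrier_laurent_ring uminus)
  have "{a + b |a b. a \<in> Poly_Mapping.keys f \<and> b \<in> Poly_Mapping.keys g} \<subseteq> expo_lattice n"
    if "f \<in> carrier (laurent_ring n)" "g \<in> carrier (laurent_ring n)"
    using that by (auto simp: carrier_laurent_ring intro!: expo_lattice_add)
  then show "f * g \<in> carrier (laurent_ring n)"
    if "f \<in> carrier (laurent_ring n)" "g \<in> carrier (laurent_ring n)"
    using that Poly_Mapping.keys_mult[of f g] unfolding carrier_laurent_ring by blast
qed (auto simp: carrier_laurent_ring)

lemma cring_laurent_ring: "cring (laurent_ring n :: 'k::field laurent ring)"
proof (intro cringI abelian_groupI comm_monoidI)
  fix f :: "'k laurent" assume "f \<in> carrier (laurent_ring n)"
  then show "\<exists>g\<in>carrier (laurent_ring n). g \<oplus>\<^bsub>laurent_ring n\<^esub> f = \<zero>\<^bsub>laurent_ring n\<^esub>"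
    by (intro bexI[of _ "- f"]) (auto simp: carrier_closed)
qed (auto simp: carrier_closed algebra_simps)

lemma unit_expo_in [simp]: "unit_expo e \<in> expo_lattice n \<longleftrightarrow> e \<in> pairs n"
  by (simp add: unit_expo_def expo_lattice_def)

lemma plucker_var_in:
  "k \<noteq> l \<Longrightarrow> k \<in> {1..n} \<Longrightarrow> l \<in> {1..n} \<Longrightarrow> plucker_var k l \<in> carrier (laurent_ring n)"
  by (simp add: plucker_var_def carrier_laurent_ring)

lemma plucker_relations_subset: "plucker_relations n \<subseteq> carrier (laurent_ring n)"
  by (auto simp: plucker_relations_def intro!: carrier_closed plucker_var_in)

lemma ideal_plucker_ideal: "ideal (plucker_ideal n) (laurent_ring n)"
  unfolding plucker_ideal_def
  by (rule ring.genideal_ideal[OF cring.axioms(1)[OF cring_laurent_ring] plucker_relations_subset])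

lemma plucker_ideal_subsetI:
  assumes "ideal I (laurent_ring n)" "plucker_relations n \<subseteq> I"
  shows "plucker_ideal n \<subseteq> I"
  unfolding plucker_ideal_def
  by (rule ring.genideal_minimal[OF cring.axioms(1)[OF cring_laurent_ring] assms])

lemma idealI_laurent:
  assumes "I \<subseteq> carrier (laurent_ring n)" "0 \<in> I"
    and "\<And>f g. f \<in> I \<Longrightarrow> g \<in> I \<Longrightarrow> f + g \<in> I"
    and "\<And>f g. f \<in> I \<Longrightarrow> g \<in> carrier (laurent_ring n) \<Longrightarrow> g * f \<in> I"
  shows "ideal I (laurent_ring n :: 'k::field laurent ring)"
proof -
  interpret R: cring "laurent_ring n :: 'k laurent ring"
    by (rule cring_laurent_ring)
  show ?thesis
  proof (rule idealI)
    show "ring (laurent_ring n :: 'k laurent ring)" ..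
    show "subgroup I (add_monoid (laurent_ring n))"
    proof (rule R.add.subgroupI)
      fix f assume "f \<in> I"
      then have f: "f \<in> carrier (laurent_ring n)"
        using assms(1) by blast
      have "\<ominus>\<^bsub>laurent_ring n\<^esub> f = - f"
        using f by (intro R.minus_equality) (auto simp: carrier_closed)
      moreover have "- 1 * f \<in> I"
        using \<open>f \<in> I\<close> by (intro assms) (auto intro!: carrier_closed)
      ultimately show "\<ominus>\<^bsub>laurent_ring n\<^esub> f \<in> I"
        by simp
    qed (use assms in auto)
  qed (use assms in \<open>auto simp: mult.commute\<close>)
qed

lemma plucker_ideal_closed:
  fixes f g :: "'k::field laurent"
  shows "(0 :: 'k laurent) \<in> plucker_ideal n"
    and "f \<in> plucker_ideal n \<Longrightarrow> f \<in> carrier (laurent_ring n)"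
    and "f \<in> plucker_ideal n \<Longrightarrow> g \<in> plucker_ideal n \<Longrightarrow> f + g \<in> plucker_ideal n"
    and "f \<in> plucker_ideal n \<Longrightarrow> g \<in> carrier (laurent_ring n) \<Longrightarrow> g * f \<in> plucker_ideal n"
    and "f \<in> plucker_ideal n \<Longrightarrow> - f \<in> plucker_ideal n"
    and "f \<in> plucker_ideal n \<Longrightarrow> g \<in> plucker_ideal n \<Longrightarrow> f - g \<in> plucker_ideal n"
proof -
  interpret ideal "plucker_ideal n" "laurent_ring n :: 'k laurent ring"
    by (rule ideal_plucker_ideal)
  show "(0 :: 'k laurent) \<in> plucker_ideal n"
    using additive_subgroup.zero_closed[OF is_additive_subgroup] by simp
  show "f \<in> carrier (laurent_ring n)" if "f \<in> plucker_ideal n"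
    using that Icarr by blast
  show add: "f + g \<in> plucker_ideal n" if "f \<in> plucker_ideal n" "g \<in> plucker_ideal n" for f g :: "'k laurent"
    using additive_subgroup.a_closed[OF is_additive_subgroup that] by simp
  show mult: "g * f \<in> plucker_ideal n"
    if "f \<in> plucker_ideal n" "g \<in> carrier (laurent_ring n)" for f g :: "'k laurent"
    using I_l_closed[OF that] by simp
  show uminus: "- f \<in> plucker_ideal n" if "f \<in> plucker_ideal n" for f :: "'k laurent"
    using mult[OF that, of "- 1"] by (auto simp: carrier_closed)
  show "f - g \<in> plucker_ideal n" if "f \<in> plucker_ideal n" "g \<in> plucker_ideal n"
    using add[OF that(1) uminus[OF that(2)]] by simp
qed

lemma plucker_ideal_sum:
  "(\<And>a. a \<in> A \<Longrightarrow> f a \<in> plucker_ideal n) \<Longrightarrow> sum f A \<in> plucker_ideal n"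
  by (induction A rule: infinite_finite_induct) (auto simp: plucker_ideal_closed)

lemma laurent_class_eq: "laurent_class n f = (\<lambda>h. h + f) ` plucker_ideal n"
  by (auto simp: laurent_class_def a_r_coset_def')

lemma laurent_class_eq_iff:
  "laurent_class n f = laurent_class n g \<longleftrightarrow> f - g \<in> plucker_ideal n"
proof
  assume "laurent_class n f = laurent_class n g"
  moreover have "f \<in> laurent_class n f"
    using plucker_ideal_closed(1) by (force simp: laurent_class_eq)
  ultimately show "f - g \<in> plucker_ideal n"
    by (auto simp: laurent_class_eq)
next
  assume *: "f - g \<in> plucker_ideal n"
  have "h + f \<in> laurent_class n g" if "h \<in> plucker_ideal n" for h
    using plucker_ideal_closed(3)[OF that *] by (auto simp: laurent_class_eq intro!: image_eqI[of _ _ "h + (f - g)"])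
  moreover have "h + g \<in> laurent_class n f" if "h \<in> plucker_ideal n" for h
    using plucker_ideal_closed(6)[OF that *] by (auto simp: laurent_class_eq intro!: image_eqI[of _ _ "h - (f - g)"])
  ultimately show "laurent_class n f = laurent_class n g"
    by (auto simp: laurent_class_eq[of n f] laurent_class_eq[of n g])
qed

lemma laurent_class_self: "f \<in> laurent_class n f"
  using plucker_ideal_closed(1) by (force simp: laurent_class_eq)

lemma Gr0_ring_ops:
  assumes "f \<in> carrier (laurent_ring n)" "g \<in> carrier (laurent_ring n)"
  shows "laurent_class n f \<oplus>\<^bsub>Gr0_ring n\<^esub> laurent_class n g = laurent_class n (f + g)"
    and "laurent_class n f \<otimes>\<^bsub>Gr0_ring n\<^esub> laurent_class n g = laurent_class n (f * g)"
  using assms ideal.rcoset_mult_add[OF ideal_plucker_ideal assms] ideal.a_rcos_sum[OF ideal_plucker_ideal assms]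
  by (auto simp: Gr0_ring_def FactRing_def laurent_class_def)

lemma Gr0_ring_0: "\<zero>\<^bsub>Gr0_ring n\<^esub> = laurent_class n 0"
  by (auto simp: Gr0_ring_def FactRing_def laurent_class_eq)

lemma Gr0_ring_1: "\<one>\<^bsub>Gr0_ring n\<^esub> = laurent_class n 1"
  by (auto simp: Gr0_ring_def FactRing_def laurent_class_def)

lemma Gr0_quotient_ring_ops [simp]:
  "add (Gr0_quotient_ring n) = add (Gr0_ring n)" "mult (Gr0_quotient_ring n) = mult (Gr0_ring n)"
  "ring.zero (Gr0_quotient_ring n) = ring.zero (Gr0_ring n)" "one (Gr0_quotient_ring n) = one (Gr0_ring n)"
  by (simp_all add: Gr0_quotient_ring_def)

section \<open>Torus weights and the invariant lattice\<close>

lemma lookup_torus_weight_superset: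
  assumes "finite A" "Poly_Mapping.keys \<alpha> \<subseteq> A"
  shows "Poly_Mapping.lookup (torus_weight \<alpha>) k =
    (\<Sum>e\<in>A. if finite e \<and> k \<in> e then Poly_Mapping.lookup \<alpha> e else 0)"
proof -
  \<comment> \<open>Exponents are not confined to the lattice here, so \<open>e\<close> may be
    infinite; the sum over it is then 0 by convention.\<close>
  have "(\<Sum>j\<in>e. Poly_Mapping.lookup (Poly_Mapping.single j a) k) = (if finite e \<and> k \<in> e then a else 0)"
    for e and a :: int
    by (cases "finite e") (auto simp: lookup_single when_def sum.delta)
  then have "Poly_Mapping.lookup (torus_weight \<alpha>) k =
      (\<Sum>e\<in>Poly_Mapping.keys \<alpha>. if finite e \<and> k \<in> e then Poly_Mapping.lookup \<alpha> e else 0)"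
    by (simp add: torus_weight_def lookup_sum)
  also have "\<dots> = (\<Sum>e\<in>A. if finite e \<and> k \<in> e then Poly_Mapping.lookup \<alpha> e else 0)"
    using assms by (intro sum.mono_neutral_left) (auto simp: in_keys_iff)
  finally show ?thesis .
qed

lemma torus_weight_add: "torus_weight (\<alpha> + \<beta>) = torus_weight \<alpha> + torus_weight \<beta>"
proof (rule poly_mapping_eqI)
  fix k
  let ?A = "Poly_Mapping.keys \<alpha> \<union> Poly_Mapping.keys \<beta>"
  have "finite ?A" "Poly_Mapping.keys (\<alpha> + \<beta>) \<subseteq> ?A" "Poly_Mapping.keys \<alpha> \<subseteq> ?A" "Poly_Mapping.keys \<beta> \<subseteq> ?A"
    using Poly_Mapping.keys_add[of \<alpha> \<beta>] by auto
  then show "Poly_Mapping.lookup (torus_weight (\<alpha> + \<beta>)) k = Poly_Mapping.lookup (torus_weight \<alpha> + torus_weight \<beta>) k"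
    by (simp add: lookup_torus_weight_superset[of ?A] lookup_add flip: sum.distrib)
      (auto simp: lookup_add intro!: sum.cong)
qed

lemma torus_weight_0 [simp]: "torus_weight 0 = 0"
  by (simp add: torus_weight_def)

lemma torus_weight_pair: "k \<noteq> l \<Longrightarrow> torus_weight (unit_expo {k, l}) = Poly_Mapping.single k 1 + Poly_Mapping.single l 1"
  by (simp add: torus_weight_def unit_expo_def)

lemma finite_pairs [simp]: "finite (nsets {Suc 0..n} 2)"
  by (simp add: finite_imp_finite_nsets)

lemma sum_pairs_containing:
  assumes "k \<in> {1..n}"
  shows "(\<Sum>e\<in>pairs n. if k \<in> e then f e else 0) = (\<Sum>l\<in>{1..n} - {k}. f {k, l} :: 'a::comm_monoid_add)"
proof -
  have "(\<Sum>e\<in>pairs n. if k \<in> e then f e else 0) = (\<Sum>e\<in>{e \<in> pairs n. k \<in> e}. f e)"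
    by (simp add: sum.inter_filter)
  also have "{e \<in> pairs n. k \<in> e} = (\<lambda>l. {k, l}) ` ({1..n} - {k})"
  proof (intro equalityI subsetI)
    fix e assume "e \<in> {e \<in> pairs n. k \<in> e}"
    then obtain i j where "e = {i, j}" "1 \<le> i" "i < j" "j \<le> n" "k = i \<or> k = j"
      unfolding in_pairs_iff by blast
    then show "e \<in> (\<lambda>l. {k, l}) ` ({1..n} - {k})"
      by (auto simp: insert_commute)
  qed (use assms in auto)
  also have "sum f \<dots> = (\<Sum>l\<in>{1..n} - {k}. f {k, l})"
    by (subst sum.reindex) (auto simp: inj_on_def doubleton_eq_iff)
  finally show ?thesis .
qed

text \<open>The coefficient of the weight at \<open>k\<close> is the row sum of
  \<open>\<alpha>\<close> at \<open>k\<close>.\<close>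

lemma invariant_lattice_iff:
  "\<alpha> \<in> invariant_lattice n \<longleftrightarrow> \<alpha> \<in> expo_lattice n \<and> torus_weight \<alpha> = 0"
proof (cases "\<alpha> \<in> expo_lattice n")
  case True
  have fin: "finite e" if "e \<in> pairs n" for e
    using that by (auto simp: nsets_def)
  have *: "Poly_Mapping.lookup (torus_weight \<alpha>) k =
      (\<Sum>e\<in>pairs n. if k \<in> e then Poly_Mapping.lookup \<alpha> e else 0)" for k
    using True by (subst lookup_torus_weight_superset[of "pairs n"])
      (auto simp: expo_lattice_def fin intro!: sum.cong)
  have outside: "Poly_Mapping.lookup (torus_weight \<alpha>) k = 0" if "k \<notin> {1..n}" for k
    unfolding * using that by (intro sum.neutral) (auto simp: nsets_def subset_iff)
  have "torus_weight \<alpha> = 0 \<longleftrightarrow> (\<forall>k. Poly_Mapping.lookup (torus_weight \<alpha>) k = 0)"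
    by (simp add: poly_mapping_eq_iff fun_eq_iff)
  also have "\<dots> \<longleftrightarrow> (\<forall>k\<in>{1..n}. Poly_Mapping.lookup (torus_weight \<alpha>) k = 0)"
    using outside by blast
  also have "\<dots> \<longleftrightarrow> (\<forall>k\<in>{1..n}. (\<Sum>l\<in>{1..n} - {k}. Poly_Mapping.lookup \<alpha> {k, l}) = 0)"
    by (intro ball_cong) (simp_all only: * sum_pairs_containing)
  finally show ?thesis
    using True by (simp add: invariant_lattice_def)
qed (simp add: invariant_lattice_def)

text \<open>Every pair has two elements, so adding up the vanishing row sums counts each exponent
  twice.\<close>

lemma invariant_degree:
  assumes "\<alpha> \<in> invariant_lattice n"
  shows "(\<Sum>e\<in>pairs n. Poly_Mapping.lookup \<alpha> e) = 0"
proof -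
  have "0 = (\<Sum>k\<in>{1..n}. \<Sum>l\<in>{1..n} - {k}. Poly_Mapping.lookup \<alpha> {k, l})"
    using assms by (simp add: invariant_lattice_def)
  also have "\<dots> = (\<Sum>k\<in>{1..n}. \<Sum>e\<in>pairs n. if k \<in> e then Poly_Mapping.lookup \<alpha> e else 0)"
    by (intro sum.cong refl sum_pairs_containing[symmetric])
  also have "\<dots> = (\<Sum>e\<in>pairs n. \<Sum>k\<in>{1..n}. if k \<in> e then Poly_Mapping.lookup \<alpha> e else 0)"
    by (rule sum.swap)
  also have "\<dots> = (\<Sum>e\<in>pairs n. 2 * Poly_Mapping.lookup \<alpha> e)"
  proof (rule sum.cong)
    fix e assume "e \<in> pairs n"
    then have "{1..n} \<inter> {k. k \<in> e} = e" "card e = 2"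
      by (auto simp: nsets_def)
    then show "(\<Sum>k\<in>{1..n}. if k \<in> e then Poly_Mapping.lookup \<alpha> e else 0) = 2 * Poly_Mapping.lookup \<alpha> e"
      by (simp add: sum.If_cases)
  qed simp
  finally show ?thesis
    by (simp flip: sum_distrib_left)
qed

section \<open>The grading by torus weight\<close>

abbreviation weight_part :: "(nat \<Rightarrow>\<^sub>0 int) \<Rightarrow> 'k::field laurent \<Rightarrow> 'k laurent" where
  "weight_part w f \<equiv> Poly_Mapping.lookup (coaction f) w"

lemma lookup_weight_part:
  "Poly_Mapping.lookup (weight_part w f) \<alpha> = (if torus_weight \<alpha> = w then Poly_Mapping.lookup f \<alpha> else 0)"
proof -
  have "Poly_Mapping.lookup (weight_part w f) \<alpha> = (\<Sum>\<beta>\<in>Poly_Mapping.keys f.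
      if \<beta> = \<alpha> then (if torus_weight \<alpha> = w then Poly_Mapping.lookup f \<alpha> else 0) else 0)"
    unfolding coaction_def lookup_sum by (rule sum.cong) (auto simp: lookup_single when_def)
  then show ?thesis
    by (auto simp: sum.delta in_keys_iff)
qed

lemma weight_part_add: "weight_part w (f + g) = weight_part w f + weight_part w g"
  by (rule poly_mapping_eqI) (simp add: lookup_weight_part lookup_add)

lemma weight_part_0 [simp]: "weight_part w 0 = 0"
  by (rule poly_mapping_eqI) (simp add: lookup_weight_part)

lemma weight_part_sum: "weight_part w (sum f A) = (\<Sum>a\<in>A. weight_part w (f a))"
  by (induction A rule: infinite_finite_induct) (auto simp: weight_part_add)

lemma weight_part_homogeneous:
  assumes "\<And>\<alpha>. \<alpha> \<in> Poly_Mapping.keys f \<Longrightarrow> torus_weight \<alpha> = u"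
  shows "weight_part w f = (if w = u then f else 0)"
  by (rule poly_mapping_eqI) (use assms in \<open>auto simp: lookup_weight_part in_keys_iff\<close>)

lemma weight_part_monomial_mult:
  "weight_part w (Poly_Mapping.single \<alpha> a * f) =
     Poly_Mapping.single \<alpha> a * weight_part (w - torus_weight \<alpha>) f"
proof -
  have *: "weight_part w (Poly_Mapping.single \<alpha> a * Poly_Mapping.single \<beta> b) =
      Poly_Mapping.single \<alpha> a * weight_part (w - torus_weight \<alpha>) (Poly_Mapping.single \<beta> b)" for \<beta> b
  proof -
    have "weight_part w (Poly_Mapping.single (\<alpha> + \<beta>) (a * b)) =
        (if w = torus_weight \<alpha> + torus_weight \<beta> then Poly_Mapping.single (\<alpha> + \<beta>) (a * b) else 0)"
      by (rule weight_part_homogeneous) (auto simp: torus_weight_add split: if_splits)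
    moreover have "weight_part (w - torus_weight \<alpha>) (Poly_Mapping.single \<beta> b) =
        (if w - torus_weight \<alpha> = torus_weight \<beta> then Poly_Mapping.single \<beta> b else 0)"
      by (rule weight_part_homogeneous) (auto split: if_splits)
    ultimately show ?thesis
      by (simp add: mult_single diff_eq_eq add.commute)
  qed
  have "weight_part w (Poly_Mapping.single \<alpha> a *
        (\<Sum>\<beta>\<in>Poly_Mapping.keys f. Poly_Mapping.single \<beta> (Poly_Mapping.lookup f \<beta>))) =
      Poly_Mapping.single \<alpha> a * weight_part (w - torus_weight \<alpha>)
        (\<Sum>\<beta>\<in>Poly_Mapping.keys f. Poly_Mapping.single \<beta> (Poly_Mapping.lookup f \<beta>))"
    by (simp add: sum_distrib_left weight_part_sum *)
  then show ?thesis
    by (simp add: sum_monomials)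
qed

text \<open>Each of the three products uses the indices i, j, k, l exactly once, so the relation is
  homogeneous.\<close>

lemma weight_part_plucker_relation:
  assumes "f \<in> plucker_relations n"
  obtains u where "\<And>w. weight_part w f = (if w = u then f else 0)"
proof -
  obtain i j k l where f: "f = plucker_var i j * plucker_var k l - plucker_var i k * plucker_var j l
        + plucker_var i l * plucker_var j k" and *: "1 \<le> i" "i < j" "j < k" "k < l" "l \<le> n"
    using assms by (auto simp: plucker_relations_def)
  let ?u = "torus_weight (unit_expo {i, j} + unit_expo {k, l})"
  let ?K = "{unit_expo {i, j} + unit_expo {k, l}, unit_expo {i, k} + unit_expo {j, l},
    unit_expo {i, l} + unit_expo {j, k}}"
  have "Poly_Mapping.keys f \<subseteq> ?K"
  proof
    fix \<alpha> assume "\<alpha> \<in> Poly_Mapping.keys f"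
    then show "\<alpha> \<in> ?K"
      by (auto simp: f in_keys_iff lookup_add lookup_minus plucker_var_def mult_single lookup_single when_def
          split: if_splits)
  qed
  moreover have "torus_weight \<alpha> = ?u" if "\<alpha> \<in> ?K" for \<alpha>
    using that * by (auto simp: torus_weight_add torus_weight_pair add_ac)
  ultimately show ?thesis
    using weight_part_homogeneous[of f ?u] by (intro that) blast
qed

text \<open>An ideal with homogeneous generators contains the homogeneous parts of its elements: the
  polynomials whose parts all lie in it form an ideal that contains the generators.\<close>

lemma weight_part_plucker_ideal:
  fixes f :: "'k::field laurent"
  assumes "f \<in> plucker_ideal n"
  shows "weight_part w f \<in> plucker_ideal n"
proof -
  \<comment> \<open>All weights are required at once, because multiplication by a monomial shifts
    the weight.\<close>
  let ?I = "{f :: 'k laurent. f \<in> carrier (laurent_ring n) \<and> (\<forall>w. weight_part w f \<in> plucker_ideal n)}"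
  have "ideal ?I (laurent_ring n)"
  proof (rule idealI_laurent)
    fix f g :: "'k laurent" assume f: "f \<in> ?I" and g: "g \<in> carrier (laurent_ring n)"
    have "weight_part w (g * f) \<in> plucker_ideal n" for w
    proof -
      have "weight_part w (g * f) = (\<Sum>\<alpha>\<in>Poly_Mapping.keys g.
          weight_part w (Poly_Mapping.single \<alpha> (Poly_Mapping.lookup g \<alpha>) * f))"
        by (subst sum_monomials[of g, symmetric]) (simp only: sum_distrib_right weight_part_sum)
      also have "\<dots> \<in> plucker_ideal n"
        using f g by (auto simp: weight_part_monomial_mult carrier_laurent_ring
            intro!: plucker_ideal_sum plucker_ideal_closed(4))
      finally show ?thesis .
    qed
    with f g show "g * f \<in> ?I"
      by (auto intro: carrier_closed)
  qed (auto intro: carrier_closed plucker_ideal_closed simp: weight_part_add)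
  moreover have "plucker_relations n \<subseteq> ?I"
  proof
    fix f :: "'k laurent" assume f: "f \<in> plucker_relations n"
    have "f \<in> plucker_ideal n"
      using f ring.genideal_self[OF cring.axioms(1)[OF cring_laurent_ring] plucker_relations_subset]
      unfolding plucker_ideal_def by blast
    moreover obtain u where "\<And>w. weight_part w f = (if w = u then f else 0)"
      by (rule weight_part_plucker_relation[OF f]) blast
    ultimately show "f \<in> ?I"
      by (simp add: plucker_ideal_closed)
  qed
  ultimately show ?thesis
    using plucker_ideal_subsetI assms by blast
qed

text \<open>This is K[N], the coordinate ring of the torus in which the quotient embeds.\<close>

definition invariant_laurent :: "nat \<Rightarrow> 'k::field laurent set" where
  "invariant_laurent n = {f. Poly_Mapping.keys f \<subseteq> invariant_lattice n}"

lemma invariant_laurent_in_carrier: "f \<in> invariant_laurent n \<Longrightarrow> f \<in> carrier (laurent_ring n)"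
  by (auto simp: invariant_laurent_def carrier_laurent_ring invariant_lattice_iff)

text \<open>Invariance at weight 0 says that a class is represented by the weight-0 part of any
  representative. The converse rests on homogeneity of the ideal.\<close>

lemma carrier_Gr0_quotient_ring:
  "carrier (Gr0_quotient_ring n) = laurent_class n ` invariant_laurent n"
proof (intro equalityI subsetI)
  fix X :: "'a laurent set" assume "X \<in> carrier (Gr0_quotient_ring n)"
  then obtain f where f: "X = laurent_class n f" "f \<in> carrier (laurent_ring n)" "torus_invariant n X"
    by (auto simp: Gr0_quotient_ring_def Gr0_ring_def)
  have "X = laurent_class n (weight_part 0 f)"
    using f laurent_class_self[of f n] by (simp add: torus_invariant_def)
  moreover have "weight_part 0 f \<in> invariant_laurent n"
    using f(2) by (auto simp: invariant_laurent_def invariant_lattice_iff carrier_laurent_ring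
        in_keys_iff lookup_weight_part split: if_splits)
  ultimately show "X \<in> laurent_class n ` invariant_laurent n"
    by blast
next
  fix X :: "'a laurent set" assume "X \<in> laurent_class n ` invariant_laurent n"
  then obtain f where f: "f \<in> invariant_laurent n" "X = laurent_class n f"
    by blast
  have part: "weight_part w f = (if w = 0 then f else 0)" for w
    using f(1) by (intro weight_part_homogeneous) (auto simp: invariant_laurent_def invariant_lattice_iff)
  have "torus_invariant n X"
    unfolding torus_invariant_def
  proof (intro ballI allI)
    fix g w assume "g \<in> X"
    then obtain h where h: "h \<in> plucker_ideal n" "g = h + f"
      by (auto simp: f laurent_class_eq)
    \<comment> \<open>The invariant summand \<open>f\<close> cancels at every weight; what remains
      comes from \<open>h\<close> and stays in the ideal.\<close>
    have "weight_part w g - Poly_Mapping.lookup (Poly_Mapping.single 0 g) w =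
        (if w = 0 then weight_part w h - h else weight_part w h)"
      by (simp add: h weight_part_add part lookup_single)
    then show "laurent_class n (weight_part w g) = laurent_class n (Poly_Mapping.lookup (Poly_Mapping.single 0 g) w)"
      using h(1) by (simp add: laurent_class_eq_iff plucker_ideal_closed weight_part_plucker_ideal)
  qed
  then show "X \<in> carrier (Gr0_quotient_ring n)"
    using f invariant_laurent_in_carrier[OF f(1)] invariant_degree
    by (auto simp: Gr0_quotient_ring_def Gr0_ring_def invariant_laurent_def)
qed

lemma invariant_laurent_closed:
  fixes f g :: "'k::field laurent"
  shows "(0 :: 'k laurent) \<in> invariant_laurent n" "(1 :: 'k laurent) \<in> invariant_laurent n"
    and "f \<in> invariant_laurent n \<Longrightarrow> g \<in> invariant_laurent n \<Longrightarrow> f + g \<in> invariant_laurent n"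
    and "f \<in> invariant_laurent n \<Longrightarrow> g \<in> invariant_laurent n \<Longrightarrow> f * g \<in> invariant_laurent n"
    and "\<alpha> \<in> invariant_lattice n \<Longrightarrow> Poly_Mapping.single \<alpha> a \<in> invariant_laurent n"
proof -
  show "f + g \<in> invariant_laurent n" if "f \<in> invariant_laurent n" "g \<in> invariant_laurent n"
    using that Poly_Mapping.keys_add[of f g] unfolding invariant_laurent_def by blast
  have "{a + b |a b. a \<in> Poly_Mapping.keys f \<and> b \<in> Poly_Mapping.keys g} \<subseteq> invariant_lattice n"
    if "f \<in> invariant_laurent n" "g \<in> invariant_laurent n"
  proof clarify
    fix a b assume "a \<in> Poly_Mapping.keys f" "b \<in> Poly_Mapping.keys g"
    with that have "a \<in> invariant_lattice n" "b \<in> invariant_lattice n"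
      by (auto simp: invariant_laurent_def)
    then show "a + b \<in> invariant_lattice n"
      by (simp add: invariant_lattice_iff expo_lattice_add torus_weight_add)
  qed
  then show "f * g \<in> invariant_laurent n" if "f \<in> invariant_laurent n" "g \<in> invariant_laurent n"
    using that Poly_Mapping.keys_mult[of f g] unfolding invariant_laurent_def by blast
qed (auto simp: invariant_laurent_def invariant_lattice_iff)

section \<open>The points of the skeleton\<close>

text \<open>The representative may be arbitrary: evaluation kills the Pluecker ideal, so on
  ultrametrics \<open>tree_norm\<close> depends on the class alone
  (\<open>tree_norm_cong\<close>).\<close>

definition skeleton_point ::
  "('k::field \<Rightarrow> real) \<Rightarrow> nat \<Rightarrow> (nat set \<Rightarrow> real) \<Rightarrow> 'k laurent set \<Rightarrow> real" where
  "skeleton_point v n x = (\<lambda>X\<in>carrier (Gr0_quotient_ring n).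
     tree_norm v n x (SOME f. f \<in> invariant_laurent n \<and> X = laurent_class n f))"

lemma (in tree) plucker_eval_plucker_ideal:
  assumes "f \<in> plucker_ideal n"
  shows "plucker_eval n p (f :: 'k laurent) = 0"
proof -
  have "plucker_ideal n \<subseteq> {f \<in> carrier (laurent_ring n). plucker_eval n p (f :: 'k laurent) = 0}"
    using plucker_relations_subset plucker_eval_relation
    by (intro plucker_ideal_subsetI idealI_laurent)
      (auto simp: pl.eval_add pl.eval_mult intro: carrier_closed)
  with assms show ?thesis
    by blast
qed

context nonarch_absolute_value
begin

lemma tree_norm_cong:
  assumes "x \<in> ultrametrics n" "laurent_class n f = laurent_class n g"
  shows "tree_norm v n x f = tree_norm v n x g"
proof -
  interpret tree v n x "nearest_parent n x"
    by (rule tree_nearest_parent[OF assms(1)])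
  have "plucker_eval n (nearest_parent n x) (f - g) = 0"
    using assms(2) by (intro plucker_eval_plucker_ideal) (simp add: laurent_class_eq_iff)
  then show ?thesis
    by (simp add: tree_norm_def pl.eval_diff)
qed

lemma skeleton_point_class:
  assumes "x \<in> ultrametrics n" "f \<in> invariant_laurent n"
  shows "skeleton_point v n x (laurent_class n f) = tree_norm v n x f"
proof -
  let ?g = "SOME g. g \<in> invariant_laurent n \<and> laurent_class n f = laurent_class n g"
  have "?g \<in> invariant_laurent n \<and> laurent_class n f = laurent_class n ?g"
    using assms(2) by (rule_tac someI[where x = f]) auto
  then have "tree_norm v n x ?g = tree_norm v n x f"
    using tree_norm_cong[OF assms(1), of f ?g] by simp
  then show ?thesis
    using assms(2) by (simp add: skeleton_point_def carrier_Gr0_quotient_ring)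
qed

lemma skeleton_point_in_spec:
  assumes "x \<in> ultrametrics n"
  shows "skeleton_point v n x \<in> berkovich_spec v (const_class n) (Gr0_quotient_ring n)"
proof -
  interpret tree v n x "nearest_parent n x"
    by (rule tree_nearest_parent[OF assms(1)])
  note * = skeleton_point_class[OF assms]
  have inv0: "0 \<in> invariant_lattice n"
    by (simp add: invariant_lattice_iff)
  have nonneg: "skeleton_point v n x X \<ge> 0" if "X \<in> carrier (Gr0_quotient_ring n)" for X
    using that by (auto simp: carrier_Gr0_quotient_ring * tree_norm_def)
  show ?thesis
    unfolding berkovich_spec_def
  proof (intro CollectI conjI ballI allI)
    show "skeleton_point v n x \<in> carrier (Gr0_quotient_ring n) \<rightarrow>\<^sub>E {0..}"
      using nonneg by (auto simp: skeleton_point_def)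
    show "skeleton_point v n x \<zero>\<^bsub>Gr0_quotient_ring n\<^esub> = 0"
      by (simp add: Gr0_ring_0 * invariant_laurent_closed tree_norm_def)
    show "skeleton_point v n x \<one>\<^bsub>Gr0_quotient_ring n\<^esub> = 1"
      by (simp add: Gr0_ring_1 * invariant_laurent_closed tree_norm_def)
    fix c
    have "tree_norm v n x (Poly_Mapping.single 0 c) = v c"
      by (simp add: tree_norm_def coord_norm_monomial del: pl.eval_single)
    then show "skeleton_point v n x (const_class n c) = v c"
      by (simp add: const_class_def * invariant_laurent_closed inv0)
  next
    fix X Y :: "'k laurent set"
    assume "X \<in> carrier (Gr0_quotient_ring n)" "Y \<in> carrier (Gr0_quotient_ring n)"
    then obtain f g where fg: "f \<in> invariant_laurent n" "g \<in> invariant_laurent n"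
      "X = laurent_class n f" "Y = laurent_class n g"
      by (auto simp: carrier_Gr0_quotient_ring)
    show "skeleton_point v n x (X \<otimes>\<^bsub>Gr0_quotient_ring n\<^esub> Y) = skeleton_point v n x X * skeleton_point v n x Y"
      using fg by (simp add: Gr0_ring_ops invariant_laurent_in_carrier * invariant_laurent_closed
          tree_norm_def pl.eval_mult cn.mult)
    have "tree_norm v n x (f + g) \<le> max (tree_norm v n x f) (tree_norm v n x g)"
      by (simp add: tree_norm_def pl.eval_add cn.add_le)
    also have "\<dots> \<le> tree_norm v n x f + tree_norm v n x g"
      by (simp add: tree_norm_def)
    finally show "skeleton_point v n x (X \<oplus>\<^bsub>Gr0_quotient_ring n\<^esub> Y) \<le> skeleton_point v n x X + skeleton_point v n x Y"
      using fg by (simp add: Gr0_ring_ops invariant_laurent_in_carrier * invariant_laurent_closed)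
  qed
qed

lemma continuous_map_skeleton_point:
  "continuous_map (subtopology (Mdual_topology n) (ultrametrics n)) (Gr0_quotient_an v n) (skeleton_point v n)"
  unfolding Gr0_quotient_an_def berkovich_topology_def continuous_map_in_subtopology
    continuous_map_componentwise
proof (intro conjI ballI)
  let ?X = "subtopology (Mdual_topology n) (ultrametrics n)"
  show "skeleton_point v n ` topspace ?X \<subseteq> extensional (carrier (Gr0_quotient_ring n))"
    by (auto simp: skeleton_point_def)
  show "skeleton_point v n \<in> topspace ?X \<rightarrow> berkovich_spec v (const_class n) (Gr0_quotient_ring n)"
    using skeleton_point_in_spec by auto
  fix X :: "'k laurent set" assume "X \<in> carrier (Gr0_quotient_ring n)"
  then show "continuous_map ?X euclideanreal (\<lambda>x. skeleton_point v n x X)"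
    using continuous_map_tree_norm by (simp add: skeleton_point_def)
qed

lemma ln_skeleton_point_monomial:
  assumes "x \<in> ultrametrics n" "\<alpha> \<in> invariant_lattice n"
  shows "ln (skeleton_point v n x (monomial_class n \<alpha>)) = pairing n x \<alpha>"
proof -
  interpret tree v n x "nearest_parent n x"
    by (rule tree_nearest_parent[OF assms(1)])
  have \<alpha>: "Poly_Mapping.keys \<alpha> \<subseteq> pairs n"
    using assms(2) by (simp add: invariant_lattice_iff expo_lattice_def)
  have "skeleton_point v n x (monomial_class n \<alpha>) = tree_norm v n x (Poly_Mapping.single \<alpha> 1)"
    using assms by (simp add: monomial_class_def skeleton_point_class invariant_laurent_closed)
  also have "\<dots> = laurent_monomial (\<lambda>e. if e \<in> pairs n then exp (x e) else 1) \<alpha>"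
    by (simp add: tree_norm_def coord_norm_monomial del: pl.eval_single)
  also have "\<dots> = (\<Prod>e\<in>pairs n. exp (x e * of_int (Poly_Mapping.lookup \<alpha> e)))"
    using \<alpha> by (simp add: laurent_monomial_superset[of "pairs n"] exp_power_int mult.commute)
  also have "\<dots> = exp (pairing n x \<alpha>)"
    by (simp add: pairing_def exp_sum)
  finally show ?thesis
    by simp
qed

end

section \<open>Normalization of tropical points\<close>

text \<open>Elements of L can make all entries {k,n} zero. The freedom left is to shift all other
  entries by a common constant (coefficient - t / 2 at \<open>n\<close>, t / 2 elsewhere), and for
  \<open>n > 2\<close> this is used to make the entry {1,2} zero.\<close>

definition normalize_vec :: "nat \<Rightarrow> (nat set \<Rightarrow> real) \<Rightarrow> nat set \<Rightarrow> real" where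
  "normalize_vec n x = (\<lambda>e\<in>pairs n. if n \<in> e then 0
     else x e - (\<Sum>k\<in>e. x {k, n}) - (x {1, 2} - x {1, n} - x {2, n}))"

lemma normalize_vec_in_Mdual [simp]: "normalize_vec n x \<in> Mdual n"
  by (simp add: normalize_vec_def Mdual_def)

lemma normalize_vec_n: "1 \<le> k \<Longrightarrow> k < n \<Longrightarrow> normalize_vec n x {k, n} = 0"
  by (simp add: normalize_vec_def)

lemma normalize_vec_pair:
  assumes "1 \<le> k" "k < l" "l < n"
  shows "normalize_vec n x {k, l} =
    x {k, l} - x {k, n} - x {l, n} - (x {1, 2} - x {1, n} - x {2, n})"
  using assms by (simp add: normalize_vec_def)

lemma pairs_cases:
  assumes "e \<in> pairs n"
  obtains k where "e = {k, n}" "1 \<le> k" "k < n"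
    | k l where "e = {k, l}" "1 \<le> k" "k < l" "l < n"
  using assms unfolding in_pairs_iff by (metis le_neq_implies_less)

lemma Mdual_eqI:
  assumes "x \<in> Mdual n" "y \<in> Mdual n" "\<And>e. e \<in> pairs n \<Longrightarrow> x e = y e"
  shows "x = y"
  using assms unfolding Mdual_def by (rule PiE_ext)

lemma lineality_sum:
  assumes "e \<in> pairs n"
  shows "(\<Sum>k\<in>{1..n}. c k * lineality_vector k e) = (\<Sum>k\<in>e. c k)"
proof -
  have "{1..n} \<inter> {k. k \<in> e} = e"
    using assms by (auto simp: nsets_def)
  moreover have "(\<Sum>k\<in>{1..n}. c k * lineality_vector k e) = (\<Sum>k\<in>{1..n}. if k \<in> e then c k else 0)"
    by (intro sum.cong) (auto simp: lineality_vector_def)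
  ultimately show ?thesis
    by (simp add: sum.If_cases)
qed

lemma vec_coset_lineality_range:
  "vec_coset n (lineality_space n) x =
     range (\<lambda>c. \<lambda>e\<in>pairs n. x e + (\<Sum>k\<in>{1..n}. c k * lineality_vector k e))"
proof -
  have "(\<lambda>e\<in>pairs n. x e + restrict g (pairs n) e) = (\<lambda>e\<in>pairs n. x e + g e)" for g
    by (rule restrict_ext) simp
  moreover have "vec_coset n (lineality_space n) x = (\<lambda>y. \<lambda>e\<in>pairs n. x e + y e) `
      range (\<lambda>c. \<lambda>e\<in>pairs n. \<Sum>k\<in>{1..n}. c k * lineality_vector k e)"
    unfolding vec_coset_def lineality_space_def by blast
  ultimately show ?thesis
    by (simp only: image_image)
qed

text \<open>Adding the element of L with coefficients \<open>c\<close> changes each x_kl - x_kn -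
  x_ln by the same - 2 c_n, which the comparison with {1,2} removes. Conversely, equal
  normalizations determine suitable coefficients.\<close>

lemma vec_coset_lineality_eq:
  assumes "x \<in> Mdual n"
  shows "vec_coset n (lineality_space n) x = {y \<in> Mdual n. normalize_vec n y = normalize_vec n x}"
proof (intro equalityI subsetI)
  fix y assume "y \<in> vec_coset n (lineality_space n) x"
  then obtain c where y: "y = (\<lambda>e\<in>pairs n. x e + (\<Sum>k\<in>{1..n}. c k * lineality_vector k e))"
    unfolding vec_coset_lineality_range by blast
  have y_pair: "y {k, l} = x {k, l} + (c k + c l)"
    if "k \<noteq> l" "1 \<le> k" "k \<le> n" "1 \<le> l" "l \<le> n" for k l
  proof -
    have "{k, l} \<in> pairs n"
      using that by simp
    then show ?thesis
      using that by (simp only: y restrict_apply' lineality_sum) simp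
  qed
  have "normalize_vec n y = normalize_vec n x"
  proof (rule Mdual_eqI)
    fix e assume "e \<in> pairs n"
    then show "normalize_vec n y e = normalize_vec n x e"
      by (cases rule: pairs_cases) (auto simp: normalize_vec_n normalize_vec_pair y_pair)
  qed auto
  then show "y \<in> {y \<in> Mdual n. normalize_vec n y = normalize_vec n x}"
    by (simp add: y Mdual_def)
next
  fix y assume "y \<in> {y \<in> Mdual n. normalize_vec n y = normalize_vec n x}"
  then have y: "y \<in> Mdual n" and eq: "normalize_vec n y = normalize_vec n x"
    by auto
  define w where "w = (\<lambda>e. y e - x e)"
  \<comment> \<open>The entries {k,n} force \<open>c k = w {k, n} - c n\<close>, and then an entry
    {k,l} with \<open>k, l < n\<close> forces
    \<open>- 2 * c n = w {k, l} - w {k, n} - w {l, n}\<close>. Equality of the normalizations says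
    that the right side is \<open>t\<close> for all these pairs.\<close>
  define t where "t = w {1, 2} - w {1, n} - w {2, n}"
  define c where "c = (\<lambda>k. if k = n then - t / 2 else w {k, n} + t / 2)"
  have w: "w e = (\<Sum>k\<in>{1..n}. c k * lineality_vector k e)" if e: "e \<in> pairs n" for e
  proof -
    from e have "w e = (\<Sum>k\<in>e. c k)"
    proof (cases rule: pairs_cases)
      case (2 k l)
      then show ?thesis
        using fun_cong[OF eq, of e] by (simp add: c_def normalize_vec_pair w_def t_def)
    qed (simp add: c_def)
    then show ?thesis
      by (simp only: lineality_sum[OF e])
  qed
  have "y = (\<lambda>e\<in>pairs n. x e + (\<Sum>k\<in>{1..n}. c k * lineality_vector k e))"
  proof (rule Mdual_eqI[OF y])
    fix e assume e: "e \<in> pairs n"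
    then show "y e = (\<lambda>e\<in>pairs n. x e + (\<Sum>k\<in>{1..n}. c k * lineality_vector k e)) e"
      by (simp only: restrict_apply' flip: w) (simp add: w_def)
  qed (simp add: Mdual_def)
  then show "y \<in> vec_coset n (lineality_space n) x"
    unfolding vec_coset_lineality_range by blast
qed

text \<open>Together with \<open>vec_coset_lineality_eq\<close> this puts the normalization of a
  point of \<open>Mdual n\<close> into its own coset.\<close>

lemma normalize_vec_idem [simp]: "normalize_vec n (normalize_vec n x) = normalize_vec n x"
proof (rule Mdual_eqI)
  fix e assume "e \<in> pairs n"
  then show "normalize_vec n (normalize_vec n x) e = normalize_vec n x e"
  proof (cases rule: pairs_cases)
    case (2 k l)
    then have "normalize_vec n x {1, n} = 0" "normalize_vec n x {2, n} = 0"
      by (auto intro!: normalize_vec_n)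
    moreover have "normalize_vec n x {1, 2} = 0"
      using 2 by (subst normalize_vec_pair) auto
    ultimately show ?thesis
      using 2 by (simp add: normalize_vec_pair[of k l n "normalize_vec n x"] normalize_vec_n)
  qed (simp add: normalize_vec_n)
qed auto

text \<open>
  Pairing with these invariant monomials computes the normalized vector, so vectors that agree on
  all invariant monomials differ by an element of \<open>L\<close>.
\<close>

definition normalizing_expo :: "nat \<Rightarrow> nat \<Rightarrow> nat \<Rightarrow> expo" where
  "normalizing_expo n k l = unit_expo {k, l} - unit_expo {k, n} - unit_expo {l, n}
     - (unit_expo {1, 2} - unit_expo {1, n} - unit_expo {2, n})"

lemma torus_weight_diff: "torus_weight (\<alpha> - \<beta>) = torus_weight \<alpha> - torus_weight \<beta>"
  using torus_weight_add[of "\<alpha> - \<beta>" \<beta>] by (simp add: algebra_simps)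

lemma expo_lattice_diff: "\<alpha> \<in> expo_lattice n \<Longrightarrow> \<beta> \<in> expo_lattice n \<Longrightarrow> \<alpha> - \<beta> \<in> expo_lattice n"
  using keys_diff[of \<alpha> \<beta>] by (auto simp: expo_lattice_def)

lemma pairing_diff: "pairing n x (\<alpha> - \<beta>) = pairing n x \<alpha> - pairing n x \<beta>"
  by (simp add: pairing_def lookup_minus right_diff_distrib sum_subtractf)

lemma pairing_unit_expo: "e \<in> pairs n \<Longrightarrow> pairing n x (unit_expo e) = x e"
  by (simp add: pairing_def unit_expo_def lookup_single when_def if_distrib sum.delta cong: if_cong)

lemma normalizing_expo_in_invariant_lattice:
  assumes "1 \<le> k" "k < l" "l < n"
  shows "normalizing_expo n k l \<in> invariant_lattice n"
  unfolding invariant_lattice_iff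
proof
  show "normalizing_expo n k l \<in> expo_lattice n"
    unfolding normalizing_expo_def using assms by (intro expo_lattice_diff) auto
  show "torus_weight (normalizing_expo n k l) = 0"
    using assms by (simp add: normalizing_expo_def torus_weight_diff torus_weight_pair)
qed

lemma pairing_normalizing_expo:
  assumes "1 \<le> k" "k < l" "l < n"
  shows "pairing n x (normalizing_expo n k l) = normalize_vec n x {k, l}"
  using assms by (simp add: normalizing_expo_def pairing_diff pairing_unit_expo normalize_vec_pair)

text \<open>N annihilates L: after exchanging the sums, \<open>c k\<close> is multiplied by the row
  sum of \<open>\<alpha>\<close> at \<open>k\<close>.\<close>

lemma pairing_lineality:
  assumes "\<alpha> \<in> invariant_lattice n"
  shows "(\<Sum>e\<in>pairs n. (\<Sum>k\<in>{1..n}. c k * lineality_vector k e) * of_int (Poly_Mapping.lookup \<alpha> e)) = 0"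
proof -
  have "(\<Sum>e\<in>pairs n. (\<Sum>k\<in>{1..n}. c k * lineality_vector k e) * of_int (Poly_Mapping.lookup \<alpha> e)) =
      (\<Sum>e\<in>pairs n. \<Sum>k\<in>{1..n}. c k * (if k \<in> e then of_int (Poly_Mapping.lookup \<alpha> e) else 0))"
    by (auto simp: sum_distrib_right lineality_vector_def intro!: sum.cong)
  also have "\<dots> = (\<Sum>k\<in>{1..n}. c k * (\<Sum>e\<in>pairs n. if k \<in> e then of_int (Poly_Mapping.lookup \<alpha> e) else 0))"
    by (subst sum.swap) (simp only: sum_distrib_left)
  also have "\<dots> = (\<Sum>k\<in>{1..n}. c k * of_int (\<Sum>l\<in>{1..n} - {k}. Poly_Mapping.lookup \<alpha> {k, l}))"
    by (intro sum.cong) (simp_all only: sum_pairs_containing of_int_sum)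
  also have "\<dots> = 0"
    using assms by (intro sum.neutral) (auto simp: invariant_lattice_def simp del: of_int_sum)
  finally show ?thesis .
qed

lemma coset_of_hom_pairing:
  assumes "x \<in> Mdual n"
  shows "coset_of_hom n (pairing n x) = vec_coset n (lineality_space n) x"
proof (intro equalityI subsetI)
  fix y assume y: "y \<in> coset_of_hom n (pairing n x)"
  have "normalize_vec n y = normalize_vec n x"
  proof (rule Mdual_eqI)
    fix e assume "e \<in> pairs n"
    then show "normalize_vec n y e = normalize_vec n x e"
    proof (cases rule: pairs_cases)
      case (2 k l)
      then show ?thesis
        using y normalizing_expo_in_invariant_lattice[of k l n]
        by (auto simp: coset_of_hom_def simp flip: pairing_normalizing_expo)
    qed (simp add: normalize_vec_n)
  qed auto
  with y assms show "y \<in> vec_coset n (lineality_space n) x"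
    by (simp add: vec_coset_lineality_eq coset_of_hom_def)
next
  fix y assume y: "y \<in> vec_coset n (lineality_space n) x"
  then obtain c where *: "y = (\<lambda>e\<in>pairs n. x e + (\<Sum>k\<in>{1..n}. c k * lineality_vector k e))"
    unfolding vec_coset_lineality_range by blast
  have "pairing n y \<alpha> = pairing n x \<alpha>" if "\<alpha> \<in> invariant_lattice n" for \<alpha>
    using pairing_lineality[OF that, of c] by (simp add: pairing_def * distrib_right sum.distrib)
  then show "y \<in> coset_of_hom n (pairing n x)"
    by (simp add: coset_of_hom_def) (simp add: * Mdual_def)
qed

lemma (in nonarch_absolute_value) trop_skeleton_point:
  assumes "x \<in> Mdual n" "normalize_vec n x \<in> ultrametrics n"
  shows "trop n (skeleton_point v n (normalize_vec n x)) = vec_coset n (lineality_space n) x"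
proof -
  have "trop n (skeleton_point v n (normalize_vec n x)) = coset_of_hom n (pairing n (normalize_vec n x))"
    unfolding trop_def coset_of_hom_def using assms by (simp add: ln_skeleton_point_monomial)
  then show ?thesis
    using assms by (simp add: coset_of_hom_pairing vec_coset_lineality_eq)
qed

lemma continuous_map_normalize_vec:
  "continuous_map (Mdual_topology n) (Mdual_topology n) (normalize_vec n)"
proof -
  have "continuous_map (Mdual_topology n) euclideanreal (\<lambda>x. normalize_vec n x e)" if e: "e \<in> pairs n" for e
    using e
  proof (cases rule: pairs_cases)
    case (2 k l)
    then show ?thesis
      by (simp only: normalize_vec_pair) (intro continuous_map_diff continuous_map_coordinate; simp)
  qed (simp add: normalize_vec_n)
  then have "continuous_map (Mdual_topology n) (product_topology (\<lambda>_. euclideanreal) (pairs n))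
      (normalize_vec n)"
    unfolding continuous_map_componentwise by (auto simp: normalize_vec_def)
  then show ?thesis
    by (simp add: Mdual_topology_def)
qed

definition coset_representative :: "nat \<Rightarrow> (nat set \<Rightarrow> real) set \<Rightarrow> nat set \<Rightarrow> real" where
  "coset_representative n z =
     normalize_vec n (SOME x. x \<in> Mdual n \<and> z = vec_coset n (lineality_space n) x)"

lemma coset_representative_vec_coset:
  assumes "x \<in> Mdual n"
  shows "coset_representative n (vec_coset n (lineality_space n) x) = normalize_vec n x"
proof -
  define y where "y = (SOME y. y \<in> Mdual n \<and>
    vec_coset n (lineality_space n) x = vec_coset n (lineality_space n) y)"
  have y: "y \<in> Mdual n \<and> vec_coset n (lineality_space n) x = vec_coset n (lineality_space n) y"
    unfolding y_def by (rule someI[where x = x]) (simp add: assms)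
  then have "y \<in> vec_coset n (lineality_space n) x"
    by (auto simp: vec_coset_lineality_eq)
  then have "normalize_vec n y = normalize_vec n x"
    using assms by (simp add: vec_coset_lineality_eq)
  then show ?thesis
    by (simp add: coset_representative_def flip: y_def)
qed

text \<open>Continuity on a quotient is tested on the space above it, where the composite is
  \<open>normalize_vec\<close>.\<close>

lemma continuous_map_coset_representative:
  "continuous_map (Mdual_mod_L_topology n) (Mdual_topology n) (coset_representative n)"
proof (rule continuous_compose_quotient_map)
  show "quotient_map (Mdual_topology n) (Mdual_mod_L_topology n) (vec_coset n (lineality_space n))"
    unfolding Mdual_mod_L_topology_def by (rule quotient_map_quotient_topology)
  show "continuous_map (Mdual_topology n) (Mdual_topology n)
      (coset_representative n \<circ> vec_coset n (lineality_space n))"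
    using continuous_map_normalize_vec
    by (rule continuous_map_eq) (simp add: coset_representative_vec_coset)
qed

section \<open>Tropical points are ultrametrics\<close>

text \<open>Bernoulli only gives linear growth, which does not contradict the bound; the square of
  Bernoulli applied to an even power grows quadratically.\<close>

lemma le_1_if_powers_le_linear:
  fixes t :: real
  assumes "\<And>m. t ^ m \<le> real m + 1"
  shows "t \<le> 1"
proof (rule ccontr)
  assume "\<not> t \<le> 1"
  define d where "d = t - 1"
  have d: "0 < d"
    using \<open>\<not> t \<le> 1\<close> by (simp add: d_def)
  \<comment> \<open>Comparing (1 + m d)^2 with 2 m + 1 will leave m d^2 at most 2.\<close>
  obtain m where m: "2 / d\<^sup>2 < real m"
    using reals_Archimedean2 by blast
  have "0 < real m"
    using m d by (smt (verit) divide_nonneg_nonneg zero_le_power2)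
  have "(1 + real m * d)\<^sup>2 \<le> (t ^ m)\<^sup>2"
    using Bernoulli_inequality[of d m] d by (intro power_mono) (auto simp: d_def)
  also have "\<dots> = t ^ (2 * m)"
    by (simp add: power_mult mult.commute)
  also have "\<dots> \<le> 2 * real m + 1"
    using assms[of "2 * m"] by simp
  also have "(1 + real m * d)\<^sup>2 = 1 + 2 * (real m * d) + real m * (real m * d\<^sup>2)"
    by (simp add: power2_eq_square algebra_simps)
  finally have "real m * (real m * d\<^sup>2) \<le> real m * 2"
    using d mult_nonneg_nonneg[of "real m" d] by linarith
  then have "real m * d\<^sup>2 \<le> 2"
    using \<open>0 < real m\<close> by simp
  with m d show False
    by (simp add: field_simps)
qed

text \<open>Expand \<open>(f + g)\<^sup>m\<close> and let \<open>m \<rightarrow> \<infinity>\<close>.\<close>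

lemma nonarch_if_subadditive:
  fixes N :: "'r::comm_ring_1 \<Rightarrow> real"
  assumes D1: "1 \<in> D" and D_add: "\<And>f g. f \<in> D \<Longrightarrow> g \<in> D \<Longrightarrow> f + g \<in> D"
    and D_mult: "\<And>f g. f \<in> D \<Longrightarrow> g \<in> D \<Longrightarrow> f * g \<in> D"
    and N_nonneg: "\<And>f. f \<in> D \<Longrightarrow> 0 \<le> N f" and N1: "N 1 = 1"
    and N_add: "\<And>f g. f \<in> D \<Longrightarrow> g \<in> D \<Longrightarrow> N (f + g) \<le> N f + N g"
    and N_mult: "\<And>f g. f \<in> D \<Longrightarrow> g \<in> D \<Longrightarrow> N (f * g) = N f * N g"
    and N_nat: "\<And>m. N (of_nat m) \<le> 1"
    and fg: "f \<in> D" "g \<in> D"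
  shows "N (f + g) \<le> max (N f) (N g)"
proof -
  define M where "M = max (N f) (N g)"
  have M: "0 \<le> M" "N f \<le> M" "N g \<le> M"
    using N_nonneg fg by (auto simp: M_def le_max_iff_disj)
  have power_in: "h ^ m \<in> D" if "h \<in> D" for h m
    by (induction m) (auto simp: D1 D_mult that)
  have N_power: "N (h ^ m) = N h ^ m" if "h \<in> D" for h m
    by (induction m) (simp_all add: N1 N_mult power_in that)
  \<comment> \<open>\<open>D\<close> is closed under sums and contains 1, which yields the positive
    integers; the binomial coefficients below are positive.\<close>
  have nat_in: "of_nat (Suc m) \<in> D" for m
  proof (induction m)
    case (Suc m)
    then show ?case
      using D_add[OF D1 Suc] by (simp only: of_nat_Suc)
  qed (simp add: D1)
  have sum: "sum h {..m} \<in> D \<and> N (sum h {..m}) \<le> (\<Sum>i\<le>m. N (h i))"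
    if "\<And>i. i \<le> m \<Longrightarrow> h i \<in> D" for h and m :: nat
    using that
  proof (induction m)
    case (Suc m)
    then show ?case
      using N_add[of "sum h {..m}" "h (Suc m)"] by (force simp: D_add)
  qed simp
  have bound: "N (f + g) ^ m \<le> (real m + 1) * M ^ m" for m
  proof -
    let ?t = "\<lambda>i. of_nat (m choose i) * f ^ i * g ^ (m - i)"
    have t: "?t i \<in> D \<and> N (?t i) \<le> M ^ m" if i: "i \<le> m" for i
    proof -
      obtain b where b: "m choose i = Suc b"
        using gr0_implies_Suc[OF zero_less_binomial[OF i]] by blast
      have c: "of_nat (m choose i) \<in> D"
        using nat_in[of b] by (simp only: b)
      have cf: "of_nat (m choose i) * f ^ i \<in> D"
        using D_mult[OF c power_in[OF fg(1)]] .
      have "N (?t i) = N (of_nat (m choose i)) * N f ^ i * N g ^ (m - i)"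
        using N_mult[OF cf power_in[OF fg(2)]] N_mult[OF c power_in[OF fg(1)]] N_power fg by metis
      also have "\<dots> \<le> 1 * M ^ i * M ^ (m - i)"
        using M N_nonneg[OF fg(1)] N_nonneg[OF fg(2)] N_nonneg[OF c] N_nat
        by (intro mult_mono power_mono) (auto intro!: mult_nonneg_nonneg)
      also have "\<dots> = M ^ m"
        using that by (simp flip: power_add)
      finally show ?thesis
        using D_mult[OF cf power_in[OF fg(2)]] by simp
    qed
    have "N (f + g) ^ m = N (sum ?t {..m})"
      using N_power[of "f + g" m] fg by (simp add: D_add flip: binomial_ring)
    also have "\<dots> \<le> (\<Sum>i\<le>m. N (?t i))"
      using sum[of m ?t] t by simp
    also have "\<dots> \<le> (\<Sum>i\<le>m. M ^ m)"
      using t by (intro sum_mono) simp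
    finally show ?thesis
      by (simp add: add.commute)
  qed
  show ?thesis
  \<comment> \<open>The limit argument divides by \<open>M\<close>. If \<open>M = 0\<close>, both
    values vanish and subadditivity suffices.\<close>
  proof (cases "M = 0")
    case True
    then show ?thesis
      using M N_add[OF fg] by (simp flip: M_def)
  next
    case False
    then have "0 < M"
      using M by simp
    have "N (f + g) / M \<le> 1"
      using bound \<open>0 < M\<close> by (intro le_1_if_powers_le_linear) (simp add: power_divide pos_divide_le_eq)
    then show ?thesis
      using \<open>0 < M\<close> by (simp add: pos_divide_le_eq flip: M_def)
  qed
qed

definition degree_zero_laurent :: "nat \<Rightarrow> 'k::field laurent set" where
  "degree_zero_laurent n = {f \<in> carrier (laurent_ring n).
     \<forall>\<alpha>\<in>Poly_Mapping.keys f. (\<Sum>e\<in>pairs n. Poly_Mapping.lookup \<alpha> e) = 0}"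

lemma carrier_Gr0_ring: "carrier (Gr0_ring n) = laurent_class n ` degree_zero_laurent n"
  by (auto simp: Gr0_ring_def degree_zero_laurent_def)

lemma degree_zero_laurent_closed:
  fixes f g :: "'k::field laurent"
  shows "(1 :: 'k laurent) \<in> degree_zero_laurent n"
    and "f \<in> degree_zero_laurent n \<Longrightarrow> g \<in> degree_zero_laurent n \<Longrightarrow> f + g \<in> degree_zero_laurent n"
    and "f \<in> degree_zero_laurent n \<Longrightarrow> g \<in> degree_zero_laurent n \<Longrightarrow> f * g \<in> degree_zero_laurent n"
    and "Poly_Mapping.single 0 a \<in> degree_zero_laurent n"
proof -
  show "f + g \<in> degree_zero_laurent n" if "f \<in> degree_zero_laurent n" "g \<in> degree_zero_laurent n"
    using that Poly_Mapping.keys_add[of f g] carrier_closed(3)[of f n g] unfolding degree_zero_laurent_def by blast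
  have "(\<Sum>e\<in>pairs n. Poly_Mapping.lookup \<gamma> e) = 0"
    if fg: "f \<in> degree_zero_laurent n" "g \<in> degree_zero_laurent n"
      and \<gamma>: "\<gamma> \<in> Poly_Mapping.keys (f * g)" for \<gamma>
  proof -
    obtain \<alpha> \<beta> where "\<gamma> = \<alpha> + \<beta>" "\<alpha> \<in> Poly_Mapping.keys f" "\<beta> \<in> Poly_Mapping.keys g"
      using Poly_Mapping.keys_mult[of f g] \<gamma> by blast
    with fg show ?thesis
      by (simp add: degree_zero_laurent_def lookup_add sum.distrib)
  qed
  moreover have "f * g \<in> carrier (laurent_ring n)" if "f \<in> degree_zero_laurent n" "g \<in> degree_zero_laurent n"
    using that by (simp add: degree_zero_laurent_def carrier_closed(4))
  ultimately show "f * g \<in> degree_zero_laurent n" if "f \<in> degree_zero_laurent n" "g \<in> degree_zero_laurent n"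
    using that unfolding degree_zero_laurent_def by blast
qed (auto simp: degree_zero_laurent_def carrier_laurent_ring)

section \<open>Four-point inequalities at a point of the Grassmannian\<close>

locale Gr0_point = nonarch_absolute_value v for v :: "'k::field \<Rightarrow> real" +
  fixes n :: nat and \<gamma> :: "'k laurent set \<Rightarrow> real"
  assumes n2: "2 \<le> n" and point: "\<gamma> \<in> Gr0_an v n"
begin

text \<open>The point is a seminorm on degree-zero classes, so the rules for \<open>N\<close> are
  stated on \<open>degree_zero_laurent n\<close>.\<close>

definition N :: "'k laurent \<Rightarrow> real" where
  "N f = \<gamma> (laurent_class n f)"

lemma
  assumes "f \<in> degree_zero_laurent n" "g \<in> degree_zero_laurent n"
  shows N_nonneg: "0 \<le> N f" and N_mult: "N (f * g) = N f * N g" and N_add: "N (f + g) \<le> N f + N g"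
proof -
  have *: "laurent_class n f \<in> carrier (Gr0_ring n)" "laurent_class n g \<in> carrier (Gr0_ring n)"
    "f \<in> carrier (laurent_ring n)" "g \<in> carrier (laurent_ring n)"
    using assms by (auto simp: carrier_Gr0_ring degree_zero_laurent_def)
  then show "0 \<le> N f"
    using point by (auto simp: N_def Gr0_an_def berkovich_spec_def)
  have "\<gamma> (laurent_class n f \<otimes>\<^bsub>Gr0_ring n\<^esub> laurent_class n g) = N f * N g"
    "\<gamma> (laurent_class n f \<oplus>\<^bsub>Gr0_ring n\<^esub> laurent_class n g) \<le> N f + N g"
    using * point by (auto simp: N_def Gr0_an_def berkovich_spec_def)
  then show "N (f * g) = N f * N g" "N (f + g) \<le> N f + N g"
    using * by (auto simp: N_def Gr0_ring_ops)
qed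

lemma N_const: "N (Poly_Mapping.single 0 a) = v a"
  using point by (simp add: N_def Gr0_an_def berkovich_spec_def flip: const_class_def)

lemma N_1: "N 1 = 1"
  using N_const[of 1] by simp

lemma N_nonarch:
  assumes "f \<in> degree_zero_laurent n" "g \<in> degree_zero_laurent n"
  shows "N (f + g) \<le> max (N f) (N g)"
proof (rule nonarch_if_subadditive)
  fix m
  show "N (of_nat m) \<le> 1"
    using N_const[of "of_nat m"] of_nat_le[of m] by (simp add: single_of_nat)
qed (use assms in \<open>auto simp: degree_zero_laurent_closed N_nonneg N_1 N_mult N_add\<close>)

text \<open>A single Pluecker coordinate has degree 1 and is no function on the affine variety;
  ratios are degree-zero units.\<close>

abbreviation ratio :: "nat set \<Rightarrow> nat set \<Rightarrow> 'k laurent" where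
  "ratio e e' \<equiv> Poly_Mapping.single (unit_expo e - unit_expo e') 1"

lemma ratio_in:
  assumes "e \<in> pairs n" "e' \<in> pairs n"
  shows "ratio e e' \<in> degree_zero_laurent n"
proof -
  have "(\<Sum>d\<in>pairs n. Poly_Mapping.lookup (unit_expo e - unit_expo e') d) = 0"
    using assms by (simp add: unit_expo_def lookup_minus lookup_single when_def sum_subtractf)
  then show ?thesis
    using assms by (simp add: degree_zero_laurent_def carrier_laurent_ring expo_lattice_diff)
qed

lemma ratio_mult: "ratio e e' * ratio e' e'' = ratio e e''"
  by (simp add: mult_single)

lemma ratio_pos:
  assumes "e \<in> pairs n" "e' \<in> pairs n"
  shows "0 < N (ratio e e')"
proof -
  have "N (ratio e e') * N (ratio e' e) = 1"
    using assms by (simp add: ratio_in ratio_mult N_1 flip: N_mult)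
  then show ?thesis
    using N_nonneg[OF ratio_in[OF assms] ratio_in[OF assms]] by (cases "N (ratio e e') = 0") auto
qed

text \<open>Modulo the ideal \<open>h\<close> is - f - g. The signs are written as products with the
  constant -1, so that \<open>N_mult\<close> and \<open>N_const\<close> apply.\<close>

lemma N_le_if_sum_in_ideal:
  assumes "f \<in> degree_zero_laurent n" "g \<in> degree_zero_laurent n" "h + f + g \<in> plucker_ideal n"
  shows "N h \<le> max (N f) (N g)"
proof -
  let ?m = "Poly_Mapping.single 0 (- 1) :: 'k laurent"
  have m: "?m * f = - f" "?m * g = - g"
    by (auto simp: single_uminus)
  have "h - (- f + - g) = h + f + g"
    by simp
  then have "laurent_class n h = laurent_class n (- f + - g)"
    using assms(3) by (simp only: laurent_class_eq_iff)
  then have "N h = N (- f + - g)"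
    by (simp add: N_def)
  also have "\<dots> \<le> max (N (- f)) (N (- g))"
    using assms unfolding m[symmetric] by (intro N_nonarch) (auto intro: degree_zero_laurent_closed)
  also have "\<dots> = max (N f) (N g)"
    using assms unfolding m[symmetric] by (simp add: N_mult degree_zero_laurent_closed(4) N_const)
  finally show ?thesis .
qed

abbreviation e0 :: "nat set" where
  "e0 \<equiv> {1, 2}"

text \<open>Dividing the relation for i, j, k, n by the square of p_12 makes its terms degree-zero
  elements. Their sum lies in the ideal, so each is bounded by the larger of the other two, and
  logarithms turn this into the claim.\<close>

lemma four_point:
  fixes x assumes x: "x \<in> trop_Gr0_point n \<gamma>"
    and ijk: "1 \<le> i" "i < j" "j < k" "k < n"
  defines "a \<equiv> x {i, j} + x {k, n}" and "b \<equiv> x {i, k} + x {j, n}" and "c \<equiv> x {j, k} + x {i, n}"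
  shows "a \<le> max b c" "b \<le> max a c" "c \<le> max a b"
proof -
  have e0: "e0 \<in> pairs n"
    using ijk by simp
  have N_ratio: "N (ratio e e0) = exp (x e - x e0)" if "e \<in> pairs n" for e
  proof -
    have "x e - x e0 = ln (N (ratio e e0))"
      using x that e0 by (auto simp: trop_Gr0_point_def N_def monomial_class_def)
    then show ?thesis
      using ratio_pos[OF that e0] by simp
  qed
  have pairs: "{i, j} \<in> pairs n" "{k, n} \<in> pairs n" "{i, k} \<in> pairs n" "{j, n} \<in> pairs n"
    "{j, k} \<in> pairs n" "{i, n} \<in> pairs n"
    using ijk by auto
  define A where "A = ratio {i, j} e0 * ratio {k, n} e0"
  define B where "B = Poly_Mapping.single 0 (- 1) * (ratio {i, k} e0 * ratio {j, n} e0)"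
  define C where "C = ratio {i, n} e0 * ratio {j, k} e0"
  have in_D: "A \<in> degree_zero_laurent n" "B \<in> degree_zero_laurent n" "C \<in> degree_zero_laurent n"
    unfolding A_def B_def C_def using pairs e0
    by (auto intro!: degree_zero_laurent_closed ratio_in simp del: insert_iff)
  have "N A = N (ratio {i, j} e0) * N (ratio {k, n} e0)"
    "N B = N (ratio {i, k} e0) * N (ratio {j, n} e0)"
    "N C = N (ratio {i, n} e0) * N (ratio {j, k} e0)"
    unfolding A_def B_def C_def using pairs e0
    by (simp_all only: N_mult ratio_in degree_zero_laurent_closed N_const minus one mult_1)
  then have N_eq: "N A = exp (a - 2 * x e0)" "N B = exp (b - 2 * x e0)" "N C = exp (c - 2 * x e0)"
    using pairs by (simp_all only: N_ratio a_def b_def c_def flip: exp_add) (simp_all add: algebra_simps)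
  let ?r = "plucker_var i j * plucker_var k n - plucker_var i k * plucker_var j n
        + plucker_var i n * plucker_var j k :: 'k laurent"
  let ?s = "Poly_Mapping.single (- (unit_expo e0 + unit_expo e0)) 1 :: 'k laurent"
  have "?r \<in> plucker_relations n"
    unfolding plucker_relations_def using ijk by blast
  then have "?r \<in> plucker_ideal n"
    using ring.genideal_self[OF cring.axioms(1)[OF cring_laurent_ring] plucker_relations_subset]
    unfolding plucker_ideal_def by blast
  moreover have "?s \<in> carrier (laurent_ring n)"
  proof -
    have "0 - (unit_expo e0 + unit_expo e0) \<in> expo_lattice n"
      using e0 by (intro expo_lattice_diff expo_lattice_add expo_lattice_0) (simp_all only: unit_expo_in)
    then show ?thesis
      by (simp add: carrier_laurent_ring)
  qed
  ultimately have "?s * ?r \<in> plucker_ideal n"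
    by (rule plucker_ideal_closed(4))
  also have "?s * ?r = A + B + C"
    by (simp add: A_def B_def C_def plucker_var_def distrib_left right_diff_distrib mult_single
        single_uminus algebra_simps)
  finally have "A + B + C \<in> plucker_ideal n" .
  then have "N A \<le> max (N B) (N C)" "N B \<le> max (N A) (N C)" "N C \<le> max (N A) (N B)"
    using in_D by (auto intro!: N_le_if_sum_in_ideal simp: add_ac)
  then show "a \<le> max b c" "b \<le> max a c" "c \<le> max a b"
    by (auto simp: N_eq le_max_iff_disj)
qed

text \<open>Subtracting x_in + x_jn + x_kn from the four-point inequality leaves the ultrametric
  inequality, up to the common constant from {1,2}.\<close>

lemma normalize_tropical_in_ultrametrics:
  assumes x: "x \<in> trop_Gr0_point n \<gamma>"
  shows "normalize_vec n x \<in> ultrametrics n"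
proof -
  have four: "x {i, j} + x {k, n} \<le> max (x {i, k} + x {j, n}) (x {j, k} + x {i, n})"
    if "i \<in> {1..<n}" "j \<in> {1..<n}" "k \<in> {1..<n}" "i \<noteq> j" "j \<noteq> k" "i \<noteq> k" for i j k
  proof -
    \<comment> \<open>The relations are stated for increasing indices; the three inequalities of
      \<open>four_point\<close> cover all six orders.\<close>
    have "i < j \<and> j < k \<or> i < k \<and> k < j \<or> j < i \<and> i < k \<or> j < k \<and> k < i \<or> k < i \<and> i < j \<or> k < j \<and> j < i"
      using that by auto
    then show ?thesis
      using four_point[OF x, of i j k] four_point[OF x, of i k j] four_point[OF x, of j i k]
        four_point[OF x, of j k i] four_point[OF x, of k i j] four_point[OF x, of k j i] that
      by (elim disjE conjE) (simp_all add: insert_commute max.commute)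
  qed
  have norm: "normalize_vec n x {i, j} =
      x {i, j} - x {i, n} - x {j, n} - (x {1, 2} - x {1, n} - x {2, n})"
    if "i \<in> {1..<n}" "j \<in> {1..<n}" "i \<noteq> j" for i j
    using that normalize_vec_pair[of i j n x] normalize_vec_pair[of j i n x]
    by (cases "i < j") (auto simp: insert_commute)
  show ?thesis
    unfolding ultrametrics_def
  proof (intro CollectI conjI ballI impI)
    fix i j k assume ijk: "i \<in> {1..<n}" "j \<in> {1..<n}" "k \<in> {1..<n}" and "i \<noteq> j \<and> j \<noteq> k \<and> i \<noteq> k"
    then show "normalize_vec n x {i, j} \<le> max (normalize_vec n x {i, k}) (normalize_vec n x {j, k})"
      using four[of i j k] norm[of i j] norm[of i k] norm[of j k] by auto
  qed (auto simp: normalize_vec_n)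
qed

lemma trop_Gr0_point_nonempty: "trop_Gr0_point n \<gamma> \<noteq> {}"
proof -
  have e0: "e0 \<in> pairs n"
    using n2 by simp
  have "(\<lambda>e\<in>pairs n. ln (N (ratio e e0))) \<in> trop_Gr0_point n \<gamma>"
    unfolding trop_Gr0_point_def
  proof (intro CollectI conjI ballI)
    fix e e' assume e: "e \<in> pairs n" "e' \<in> pairs n"
    have "N (ratio e e0) = N (ratio e e') * N (ratio e' e0)"
      using e e0 by (simp add: ratio_in ratio_mult flip: N_mult)
    then have "ln (N (ratio e e0)) = ln (N (ratio e e')) + ln (N (ratio e' e0))"
      using ratio_pos e e0 by (simp add: ln_mult_pos)
    then show "(\<lambda>e\<in>pairs n. ln (N (ratio e e0))) e - (\<lambda>e\<in>pairs n. ln (N (ratio e e0))) e'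
        = ln (\<gamma> (monomial_class n (unit_expo e - unit_expo e')))"
      using e by (simp add: N_def monomial_class_def)
  qed (simp add: Mdual_def)
  then show ?thesis
    by blast
qed

text \<open>Two such vectors differ by a constant vector, which normalization removes.\<close>

lemma normalize_tropical_unique:
  assumes x: "x \<in> trop_Gr0_point n \<gamma>" and y: "y \<in> trop_Gr0_point n \<gamma>"
  shows "normalize_vec n x = normalize_vec n y"
proof -
  have *: "x e - x e' = y e - y e'" if "e \<in> pairs n" "e' \<in> pairs n" for e e'
    using x y that by (auto simp: trop_Gr0_point_def)
  have *: "x e = y e + (x e0 - y e0)" if "e \<in> pairs n" for e
    using *[OF that, of e0] n2 by simp
  show ?thesis
  proof (rule Mdual_eqI)
    fix e assume "e \<in> pairs n"
    then show "normalize_vec n x e = normalize_vec n y e"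
    proof (cases rule: pairs_cases)
      case (2 k l)
      then show ?thesis
        using *[of "{k, l}"] *[of "{k, n}"] *[of "{l, n}"] *[of "{1, n}"] *[of "{2, n}"]
        by (simp add: normalize_vec_pair)
    qed (simp add: normalize_vec_n)
  qed auto
qed

text \<open>The all-ones line lies in L, so the L-cosets over one point of the tropical Grassmannian
  coincide.\<close>

lemma tropical_coset:
  obtains x where "x \<in> Mdual n" "normalize_vec n x \<in> ultrametrics n"
    "(\<Union>y\<in>trop_Gr0_point n \<gamma>. vec_coset n (lineality_space n) y) = vec_coset n (lineality_space n) x"
proof -
  obtain x where x: "x \<in> trop_Gr0_point n \<gamma>"
    using trop_Gr0_point_nonempty by blast
  have in_M: "y \<in> Mdual n" if "y \<in> trop_Gr0_point n \<gamma>" for y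
    using that by (simp add: trop_Gr0_point_def)
  have const: "vec_coset n (lineality_space n) y = vec_coset n (lineality_space n) x" if "y \<in> trop_Gr0_point n \<gamma>" for y
    using normalize_tropical_unique[OF x that] in_M x that by (simp add: vec_coset_lineality_eq)
  have "(\<Union>y\<in>trop_Gr0_point n \<gamma>. vec_coset n (lineality_space n) y) = vec_coset n (lineality_space n) x"
    by (rule UN_constant_eq[OF x ballI[OF const]])
  then show ?thesis
    by (rule that[OF in_M[OF x] normalize_tropical_in_ultrametrics[OF x]])
qed

end

theorem corollary7p3:
  fixes v :: "'k::field \<Rightarrow> real" and n :: nat
  assumes "complete_nonarch_abs v" and "n \<ge> 2"
  shows "\<exists>\<sigma> :: (nat set \<Rightarrow> real) set \<Rightarrow> ('k laurent set \<Rightarrow> real).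
           continuous_map (subtopology (Mdual_mod_L_topology n) (trop_Gr0_mod_L v n))
             (Gr0_quotient_an v n) \<sigma> \<and>
           (\<forall>z\<in>trop_Gr0_mod_L v n. trop n (\<sigma> z) = z)"
proof -
  interpret nonarch_absolute_value v
    using assms(1) by unfold_locales (simp add: complete_nonarch_abs_def)
  have coset: "\<exists>x\<in>Mdual n. normalize_vec n x \<in> ultrametrics n \<and> z = vec_coset n (lineality_space n) x"
    if "z \<in> trop_Gr0_mod_L v n" for z
  proof -
    from that obtain \<gamma> where \<gamma>: "\<gamma> \<in> Gr0_an v n"
      "z = (\<Union>x\<in>trop_Gr0_point n \<gamma>. vec_coset n (lineality_space n) x)"
      by (auto simp: trop_Gr0_mod_L_def trop_Gr0_def)
    interpret Gr0_point v n \<gamma>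
      by unfold_locales (use assms \<gamma> in auto)
    show ?thesis
      using tropical_coset \<gamma>(2) by metis
  qed
  \<comment> \<open>The section is the skeleton point of the normalized representative, which is an
    ultrametric by \<open>coset\<close>.\<close>
  have "continuous_map (subtopology (Mdual_mod_L_topology n) (trop_Gr0_mod_L v n))
      (subtopology (Mdual_topology n) (ultrametrics n)) (coset_representative n)"
    using coset coset_representative_vec_coset
    by (intro continuous_map_into_subtopology continuous_map_from_subtopology
        continuous_map_coset_representative) fastforce
  then have "continuous_map (subtopology (Mdual_mod_L_topology n) (trop_Gr0_mod_L v n))
      (Gr0_quotient_an v n) (skeleton_point v n \<circ> coset_representative n)"
    using continuous_map_skeleton_point by (rule continuous_map_compose)
  moreover have "trop n ((skeleton_point v n \<circ> coset_representative n) z) = z"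
    if "z \<in> trop_Gr0_mod_L v n" for z
    using coset[OF that] by (auto simp: coset_representative_vec_coset trop_skeleton_point)
  ultimately show ?thesis
    by blast
qed

end
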